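(* Let $(f,g):\mathcal{C}(1)\to\mathcal{C}(2)$ be a morphism of exact couples of $R$-modules such that for $s\in\{1,2\}$: (1) the associated spectral sequences satisfy $E^r_{p,q}(s)=0$ for all $r\geq 2$ whenever $p<0$ or $q<0$; (2) for $r\geq 2$ the differential $d^r(s)$ on $E^r(s)$ has bidegree $(-r,r-1)$; (3) the $E^\infty$-objects match the colimit abutment: $L_n(s)=0$ for $n<0$ and, for each $n\geq 0$, the canonical filtration of $L_n(s)$ has the form $$0=F_{-1,n+1}(s)\subseteq F_{0,n}(s)\subseteq\cdots\subseteq F_{n,0}(s)=L_n(s),$$ with short exact sequences $0\to F_{p-1,q+1}(s)\to F_{p,q}(s)\to E^\infty_{p,q}(s)\to 0$ for $p+q=n$, compatible with the maps induced by $(f,g)$. Assume further: (i) The induced map of colimit abutment objects $L_n(f):L_n(1)\to L_n(2)$ is an isomorphism for all $n\in\mathbb{Z}$. (ii) $f^2_{0,0}:E^2_{0,0}(1)\to E^2_{0,0}(2)$ is an isomorphism. (iii) For every $n\geq0$: if $f^2_{p,0}:E^2_{p,0}(1)\to E^2_{p,0}(2)$ is an isomorphism for $0\leq p\leq n$, then $f^2_{p,q}$ is an isomorphism for all $(p,q)$ with $p\leq n$ and all $q\in\mathbb{Z}$. Then the induced map $(f^r\mid r\geq 2)$ of spectral sequences is an isomorphism.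
   Context: $R$ is a unital ring. A $(\mathbb{Z}\times\mathbb{Z})$-bigraded exact couple $(E,D,i,j,k)$ with bidegrees $\mathbf{a},\mathbf{b},\mathbf{c}\in\mathbb{Z}\times\mathbb{Z}$ consists of families of $R$-modules $D_{\mathbf{x}},E_{\mathbf{x}}$ ($\mathbf{x}\in\mathbb{Z}\times\mathbb{Z}$) and $R$-linear maps $i_{\mathbf{x}}:D_{\mathbf{x}}\to D_{\mathbf{x}+\mathbf{a}}$, $j_{\mathbf{x}}:D_{\mathbf{x}}\to E_{\mathbf{x}+\mathbf{b}}$, $k_{\mathbf{x}}:E_{\mathbf{x}}\to D_{\mathbf{x}+\mathbf{c}}$ such that $D_{\mathbf{x}-\mathbf{a}}\xrightarrow{i}D_{\mathbf{x}}\xrightarrow{j}E_{\mathbf{x}+\mathbf{b}}\xrightarrow{k}D_{\mathbf{x}+\mathbf{b}+\mathbf{c}}\xrightarrow{i}D_{\mathbf{x}+\mathbf{a}+\mathbf{b}+\mathbf{c}}$ is exact for all $\mathbf{x}$. A morphism $(f,g)$ of exact couples with equal bidegrees is a pair of families $f_{\mathbf{x}}:D_{\mathbf{x}}(1)\to D_{\mathbf{x}}(2)$, $g_{\mathbf{x}}:E_{\mathbf{x}}(1)\to E_{\mathbf{x}}(2)$ commuting with $i,j,k$. Associated spectral sequence: with $i^r$ the $r$-fold composite of $i$, put $Z^{r}_{\mathbf{x}+\mathbf{b}}=k^{-1}(\operatorname{im}\,i^{r}_{\mathbf{x}+\mathbf{b}+\mathbf{c}-r\mathbf{a}})$, $B^r_{\mathbf{x}+\mathbf{b}}=j(\ker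 i^r_{\mathbf{x}})$, $E^{r+1}=Z^r/B^r$ for $r\ge 0$; $d^r$ on $E^r$ sends the class of $e$ to the class of $j(y)$ where $i^{r-1}(y)=k(e)$; it has bidegree $\mathbf{b}+\mathbf{c}-(r-1)\mathbf{a}$, and $E^{r+1}$ is the homology of $(E^r,d^r)$. $E^\infty:=\bigcap_rZ^r/\bigcup_rB^r$. A morphism of exact couples induces a morphism $f^r:E^r(1)\to E^r(2)$ of spectral sequences ($r\leq\infty$). Condition (2) forces $\mathbf{a}=(1,-1)$ and $\mathbf{b}+\mathbf{c}=(-1,0)$. The colimit abutment $L_n$ is the colimit of the diagram $\cdots\to D_{\mathbf{x}-\mathbf{a}}\xrightarrow{i}D_{\mathbf{x}}\xrightarrow{i}D_{\mathbf{x}+\mathbf{a}}\to\cdots$ of all $D_{\mathbf{x}}$ with $\det[\mathbf{a}\ \mathbf{x}]=n$, i.e. $\mathbf{x}=(p,q)$ with $p+q=n$; its canonical filtration is by the images of the cocone maps $D_{\mathbf{x}}\to L_n$. A morphism of exact couples induces filtration-preserving maps $L_n(f):L_n(1)\to L_n(2)$. *)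

theory Defs
  imports "HOL-Algebra.AbelCoset" "HOL-Algebra.Module" "HOL-Library.Product_Plus"
begin

section \<open>Modules over a unital ring\<close>

text \<open>The library locale for modules assumes a commutative ring of scalars. The locale below has
  the same axioms, on the same record type, for an arbitrary unital ring. As in the library, the
  fields \<^const>\<open>mult\<close> and \<^const>\<open>one\<close> of the module record carry no meaning.\<close>

locale left_module = R?: ring R + M?: abelian_group M
  for R (structure) and M (structure) +
  assumes smult_closed:
      "\<lbrakk>a \<in> carrier R; x \<in> carrier M\<rbrakk> \<Longrightarrow> a \<odot>\<^bsub>M\<^esub> x \<in> carrier M"
    and smult_l_distr:
      "\<lbrakk>a \<in> carrier R; b \<in> carrier R; x \<in> carrier M\<rbrakk> \<Longrightarrow>
        (a \<oplus> b) \<odot>\<^bsub>M\<^esub> x = a \<odot>\<^bsub>M\<^esub> x \<oplus>\<^bsub>M\<^esub> b \<odot>\<^bsub>M\<^esub> x"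
    and smult_r_distr:
      "\<lbrakk>a \<in> carrier R; x \<in> carrier M; y \<in> carrier M\<rbrakk> \<Longrightarrow>
        a \<odot>\<^bsub>M\<^esub> (x \<oplus>\<^bsub>M\<^esub> y) = a \<odot>\<^bsub>M\<^esub> x \<oplus>\<^bsub>M\<^esub> a \<odot>\<^bsub>M\<^esub> y"
    and smult_assoc1:
      "\<lbrakk>a \<in> carrier R; b \<in> carrier R; x \<in> carrier M\<rbrakk> \<Longrightarrow>
        (a \<otimes> b) \<odot>\<^bsub>M\<^esub> x = a \<odot>\<^bsub>M\<^esub> (b \<odot>\<^bsub>M\<^esub> x)"
    and smult_one: "x \<in> carrier M \<Longrightarrow> \<one> \<odot>\<^bsub>M\<^esub> x = x"

definition mod_hom ::
  "('a, 'r) ring_scheme \<Rightarrow> ('a, 'm) module \<Rightarrow> ('a, 'n) module \<Rightarrow> ('m \<Rightarrow> 'n) set" where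
  "mod_hom R M N = {h. h \<in> carrier M \<rightarrow> carrier N \<and>
     (\<forall>x\<in>carrier M. \<forall>y\<in>carrier M. h (x \<oplus>\<^bsub>M\<^esub> y) = h x \<oplus>\<^bsub>N\<^esub> h y) \<and>
     (\<forall>a\<in>carrier R. \<forall>x\<in>carrier M. h (a \<odot>\<^bsub>M\<^esub> x) = a \<odot>\<^bsub>N\<^esub> h x)}"

definition mod_iso ::
  "('a, 'r) ring_scheme \<Rightarrow> ('a, 'm) module \<Rightarrow> ('a, 'n) module \<Rightarrow> ('m \<Rightarrow> 'n) set" where
  "mod_iso R M N = {h \<in> mod_hom R M N. bij_betw h (carrier M) (carrier N)}"

definition zero_module :: "('a, 'm) module \<Rightarrow> bool" where
  "zero_module M \<longleftrightarrow> carrier M = {\<zero>\<^bsub>M\<^esub>}"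

text \<open>For submodules \<open>B \<subseteq> Z\<close> of \<open>M\<close>, \<open>subquot M Z B\<close> is \<open>Z/B\<close>, whose elements are the
  cosets of \<open>B\<close>. A map defined on representatives is evaluated on a coset \<open>X\<close> by taking the union
  of the results over all representatives: if the map is well defined, all these results are the
  same coset.\<close>

definition subquot :: "('a, 'm) module \<Rightarrow> 'm set \<Rightarrow> 'm set \<Rightarrow> ('a, 'm set) module" where
  "subquot M Z B =
     \<lparr>carrier = (\<lambda>z. B +>\<^bsub>M\<^esub> z) ` Z, mult = undefined, one = undefined,
      zero = B, add = (\<lambda>X Y. X <+>\<^bsub>M\<^esub> Y),
      smult = (\<lambda>a X. \<Union>x\<in>X. B +>\<^bsub>M\<^esub> (a \<odot>\<^bsub>M\<^esub> x))\<rparr>"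

definition quot_map :: "('a, 'n) module \<Rightarrow> 'n set \<Rightarrow> ('m \<Rightarrow> 'n) \<Rightarrow> 'm set \<Rightarrow> 'n set" where
  "quot_map N B h X = (\<Union>z\<in>X. B +>\<^bsub>N\<^esub> h z)"


section \<open>Exact couples and their morphisms\<close>

type_synonym bideg = "int \<times> int"

definition zscale :: "int \<Rightarrow> bideg \<Rightarrow> bideg" where
  "zscale t x = (t * fst x, t * snd x)"

record ('a, 'd, 'e) couple =
  obD :: "bideg \<Rightarrow> ('a, 'd) module"
  obE :: "bideg \<Rightarrow> ('a, 'e) module"
  imap :: "bideg \<Rightarrow> 'd \<Rightarrow> 'd"
  jmap :: "bideg \<Rightarrow> 'd \<Rightarrow> 'e"
  kmap :: "bideg \<Rightarrow> 'e \<Rightarrow> 'd"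
  ideg :: bideg
  jdeg :: bideg
  kdeg :: bideg

locale exact_couple = ring R
  for R :: "('a, 'r) ring_scheme" (structure) and C :: "('a, 'd, 'e) couple" +
  assumes module_D: "left_module R (obD C x)"
    and module_E: "left_module R (obE C x)"
    and hom_i: "imap C x \<in> mod_hom R (obD C x) (obD C (x + ideg C))"
    and hom_j: "jmap C x \<in> mod_hom R (obD C x) (obE C (x + jdeg C))"
    and hom_k: "kmap C x \<in> mod_hom R (obE C x) (obD C (x + kdeg C))"
    and exact_ij:
      "imap C (x - ideg C) ` carrier (obD C (x - ideg C))
        = a_kernel (obD C x) (obE C (x + jdeg C)) (jmap C x)"
    and exact_jk:
      "jmap C x ` carrier (obD C x)
        = a_kernel (obE C (x + jdeg C)) (obD C (x + jdeg C + kdeg C)) (kmap C (x + jdeg C))"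
    and exact_ki:
      "kmap C (x + jdeg C) ` carrier (obE C (x + jdeg C))
        = a_kernel (obD C (x + jdeg C + kdeg C)) (obD C (x + jdeg C + kdeg C + ideg C))
            (imap C (x + jdeg C + kdeg C))"

locale couple_morphism =
  C1: exact_couple R C1 + C2: exact_couple R C2
  for R :: "('a, 'r) ring_scheme" (structure)
    and C1 :: "('a, 'd1, 'e1) couple" and C2 :: "('a, 'd2, 'e2) couple" +
  fixes f :: "bideg \<Rightarrow> 'd1 \<Rightarrow> 'd2" and g :: "bideg \<Rightarrow> 'e1 \<Rightarrow> 'e2"
  assumes same_bidegrees: "ideg C1 = ideg C2" "jdeg C1 = jdeg C2" "kdeg C1 = kdeg C2"
    and hom_f: "f x \<in> mod_hom R (obD C1 x) (obD C2 x)"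
    and hom_g: "g x \<in> mod_hom R (obE C1 x) (obE C2 x)"
    and comm_i: "d \<in> carrier (obD C1 x) \<Longrightarrow> f (x + ideg C1) (imap C1 x d) = imap C2 x (f x d)"
    and comm_j: "d \<in> carrier (obD C1 x) \<Longrightarrow> g (x + jdeg C1) (jmap C1 x d) = jmap C2 x (f x d)"
    and comm_k: "e \<in> carrier (obE C1 x) \<Longrightarrow> f (x + kdeg C1) (kmap C1 x e) = kmap C2 x (g x e)"


section \<open>The associated spectral sequence\<close>

text \<open>\<open>ipow C r x\<close> is the \<open>r\<close>-fold composite of \<open>i\<close> starting at position \<open>x\<close>.\<close>

primrec ipow :: "('a, 'd, 'e) couple \<Rightarrow> nat \<Rightarrow> bideg \<Rightarrow> 'd \<Rightarrow> 'd" where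
  "ipow C 0 x d = d"
| "ipow C (Suc r) x d = imap C (x + zscale (int r) (ideg C)) (ipow C r x d)"

definition cycles :: "('a, 'd, 'e) couple \<Rightarrow> nat \<Rightarrow> bideg \<Rightarrow> 'e set" where
  "cycles C r x =
     (let w = x + kdeg C - zscale (int r) (ideg C) in
       {e \<in> carrier (obE C x). kmap C x e \<in> ipow C r w ` carrier (obD C w)})"

definition boundaries :: "('a, 'd, 'e) couple \<Rightarrow> nat \<Rightarrow> bideg \<Rightarrow> 'e set" where
  "boundaries C r x =
     (let w = x - jdeg C in
       jmap C w ` a_kernel (obD C w) (obD C (w + zscale (int r) (ideg C))) (ipow C r w))"

text \<open>The spectral sequence starts with \<open>E\<^sup>1\<close>; the index \<open>r = 0\<close> is not used below.\<close>

definition page :: "('a, 'd, 'e) couple \<Rightarrow> nat \<Rightarrow> bideg \<Rightarrow> ('a, 'e set) module" where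
  "page C r x = subquot (obE C x) (cycles C (r - 1) x) (boundaries C (r - 1) x)"

definition page_inf :: "('a, 'd, 'e) couple \<Rightarrow> bideg \<Rightarrow> ('a, 'e set) module" where
  "page_inf C x = subquot (obE C x) (\<Inter>r. cycles C r x) (\<Union>r. boundaries C r x)"

definition diff_deg :: "('a, 'd, 'e) couple \<Rightarrow> nat \<Rightarrow> bideg" where
  "diff_deg C r = jdeg C + kdeg C - zscale (int r - 1) (ideg C)"

text \<open>The class of \<open>e\<close> goes to the class of \<open>j y\<close>, where \<open>i\<^sup>r\<^sup>-\<^sup>1 y = k e\<close>.\<close>

definition diff :: "('a, 'd, 'e) couple \<Rightarrow> nat \<Rightarrow> bideg \<Rightarrow> 'e set \<Rightarrow> 'e set" where
  "diff C r x X =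
     (let w = x + kdeg C - zscale (int r - 1) (ideg C) in
       \<Union>{boundaries C (r - 1) (w + jdeg C) +>\<^bsub>obE C (w + jdeg C)\<^esub> jmap C w y | e y.
           e \<in> X \<and> y \<in> carrier (obD C w) \<and> ipow C (r - 1) w y = kmap C x e})"

text \<open>The image in \<open>E\<^sup>r\<close> of the differential arriving at \<open>x\<close>, and the identification of
  \<open>E\<^sup>r\<^sup>+\<^sup>1\<close> with the homology of \<open>E\<^sup>r\<close> at \<open>x\<close>, which sends the class of \<open>e \<in> Z\<^sup>r\<close> modulo \<open>B\<^sup>r\<close> to the
  homology class of the class of \<open>e\<close> modulo \<open>B\<^sup>r\<^sup>-\<^sup>1\<close>.\<close>

definition diff_image :: "('a, 'd, 'e) couple \<Rightarrow> nat \<Rightarrow> bideg \<Rightarrow> 'e set set" where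
  "diff_image C r x = diff C r (x - diff_deg C r) ` carrier (page C r (x - diff_deg C r))"

definition page_to_homology ::
  "('a, 'd, 'e) couple \<Rightarrow> nat \<Rightarrow> bideg \<Rightarrow> 'e set \<Rightarrow> 'e set set" where
  "page_to_homology C r x =
     quot_map (page C r x) (diff_image C r x) (\<lambda>e. boundaries C (r - 1) x +>\<^bsub>obE C x\<^esub> e)"

text \<open>Morphisms of the spectral sequences from the second page on: linear maps of the pages which
  commute with the differentials and such that the map on each page induces, via homology, the
  map on the next one.\<close>

definition ss_morphism ::
  "('a, 'r) ring_scheme \<Rightarrow> ('a, 'd1, 'e1) couple \<Rightarrow> ('a, 'd2, 'e2) couple \<Rightarrow>
    (nat \<Rightarrow> bideg \<Rightarrow> 'e1 set \<Rightarrow> 'e2 set) \<Rightarrow> bool" where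
  "ss_morphism R C1 C2 \<phi> \<longleftrightarrow> (\<forall>r\<ge>2. \<forall>x.
     \<phi> r x \<in> mod_hom R (page C1 r x) (page C2 r x) \<and>
     (\<forall>X\<in>carrier (page C1 r x).
        \<phi> r (x + diff_deg C1 r) (diff C1 r x X) = diff C2 r x (\<phi> r x X)) \<and>
     (\<forall>X\<in>carrier (page C1 (Suc r) x).
        page_to_homology C2 r x (\<phi> (Suc r) x X)
          = quot_map (page C2 r x) (diff_image C2 r x) (\<phi> r x) (page_to_homology C1 r x X)))"

definition ss_isomorphism ::
  "('a, 'r) ring_scheme \<Rightarrow> ('a, 'd1, 'e1) couple \<Rightarrow> ('a, 'd2, 'e2) couple \<Rightarrow>
    (nat \<Rightarrow> bideg \<Rightarrow> 'e1 set \<Rightarrow> 'e2 set) \<Rightarrow> bool" where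
  "ss_isomorphism R C1 C2 \<phi> \<longleftrightarrow> ss_morphism R C1 C2 \<phi> \<and>
     (\<forall>r\<ge>2. \<forall>x. \<phi> r x \<in> mod_iso R (page C1 r x) (page C2 r x))"

text \<open>The maps \<open>f\<^sup>r\<close> and \<open>f\<^sup>\<infinity>\<close> induced by \<open>(f, g)\<close>; they only depend on the component \<open>g\<close> on \<open>E\<close>.\<close>

definition page_map ::
  "('a, 'd2, 'e2) couple \<Rightarrow> (bideg \<Rightarrow> 'e1 \<Rightarrow> 'e2) \<Rightarrow> nat \<Rightarrow> bideg \<Rightarrow> 'e1 set \<Rightarrow> 'e2 set" where
  "page_map C2 g r x = quot_map (obE C2 x) (boundaries C2 (r - 1) x) (g x)"

definition page_inf_map ::
  "('a, 'd2, 'e2) couple \<Rightarrow> (bideg \<Rightarrow> 'e1 \<Rightarrow> 'e2) \<Rightarrow> bideg \<Rightarrow> 'e1 set \<Rightarrow> 'e2 set" where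
  "page_inf_map C2 g x = quot_map (obE C2 x) (\<Union>r. boundaries C2 r x) (g x)"


section \<open>The colimit abutment\<close>

text \<open>\<open>line C n\<close> is the set of all \<open>x\<close> with \<open>det [a x] = n\<close>. When the entries of \<open>a\<close> are coprime,
  as for \<open>a = (1, -1)\<close>, it is a single chain \<open>\<dots> \<rightarrow> x - a \<rightarrow> x \<rightarrow> x + a \<rightarrow> \<dots>\<close>, so that the
  colimit is the standard sequential one: the elements of all \<open>D\<^sub>x\<close>, two of them being identified
  when they become equal further along the chain. An element of the colimit is a class of pairs
  \<open>(x, d)\<close> with \<open>d \<in> D\<^sub>x\<close>, and \<open>cocone C x\<close> is the cocone map from \<open>D\<^sub>x\<close>.\<close>

definition line :: "('a, 'd, 'e) couple \<Rightarrow> int \<Rightarrow> bideg set" where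
  "line C n = {x. fst (ideg C) * snd x - snd (ideg C) * fst x = n}"

definition cocone :: "('a, 'd, 'e) couple \<Rightarrow> bideg \<Rightarrow> 'd \<Rightarrow> (bideg \<times> 'd) set" where
  "cocone C x d = {(y, d'). d' \<in> carrier (obD C y) \<and>
     (\<exists>r s. x + zscale (int r) (ideg C) = y + zscale (int s) (ideg C) \<and>
            ipow C r x d = ipow C s y d')}"

definition colim :: "('a, 'd, 'e) couple \<Rightarrow> int \<Rightarrow> ('a, (bideg \<times> 'd) set) module" where
  "colim C n =
     \<lparr>carrier = (\<Union>x\<in>line C n. cocone C x ` carrier (obD C x)),
      mult = undefined, one = undefined,
      zero = (\<Union>x\<in>line C n. cocone C x \<zero>\<^bsub>obD C x\<^esub>),
      add = (\<lambda>X Y. \<Union>{cocone C x (d \<oplus>\<^bsub>obD C x\<^esub> d') | x d d'. (x, d) \<in> X \<and> (x, d') \<in> Y}),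
      smult = (\<lambda>a X. \<Union>(x, d)\<in>X. cocone C x (a \<odot>\<^bsub>obD C x\<^esub> d))\<rparr>"

definition colim_map ::
  "('a, 'd2, 'e2) couple \<Rightarrow> (bideg \<Rightarrow> 'd1 \<Rightarrow> 'd2) \<Rightarrow> (bideg \<times> 'd1) set \<Rightarrow> (bideg \<times> 'd2) set" where
  "colim_map C2 f X = (\<Union>(x, d)\<in>X. cocone C2 x (f x d))"

text \<open>The stage \<open>F\<^sub>p\<^sub>,\<^sub>q\<close> of the canonical filtration of \<open>L\<^sub>p\<^sub>+\<^sub>q\<close>, for \<open>a = (1, -1)\<close>. The filtration
  consists of the images of the cocone maps; the integer \<open>m\<close> fixes how these are numbered:
  \<open>F\<^sub>p\<^sub>,\<^sub>q\<close> is the image of \<open>D\<close> at position \<open>(p, q) - (m, -m)\<close>. With \<open>m = 0\<close> the numbering is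
  that of \<open>D\<close>. If \<open>b = (m, -m)\<close>, it is that of \<open>E\<close>: then \<open>j\<close> leads from this position to
  \<open>E\<^sub>p\<^sub>,\<^sub>q\<close>.\<close>

definition filt :: "('a, 'd, 'e) couple \<Rightarrow> int \<Rightarrow> bideg \<Rightarrow> (bideg \<times> 'd) set set" where
  "filt C m x = cocone C (x - (m, -m)) ` carrier (obD C (x - (m, -m)))"


section \<open>Conditions on an exact couple\<close>

definition first_quadrant :: "('a, 'd, 'e) couple \<Rightarrow> bool" where
  "first_quadrant C \<longleftrightarrow> (\<forall>r\<ge>2. \<forall>p q. p < 0 \<or> q < 0 \<longrightarrow> zero_module (page C r (p, q)))"

definition homological_bidegrees :: "('a, 'd, 'e) couple \<Rightarrow> bool" where
  "homological_bidegrees C \<longleftrightarrow> (\<forall>r\<ge>2. diff_deg C r = (- int r, int r - 1))"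

text \<open>\<open>\<pi> (p, q)\<close> is the map from \<open>F\<^sub>p\<^sub>,\<^sub>q\<close> in the short exact sequence
  \<open>0 \<rightarrow> F\<^sub>p\<^sub>-\<^sub>1\<^sub>,\<^sub>q\<^sub>+\<^sub>1 \<rightarrow> F\<^sub>p\<^sub>,\<^sub>q \<rightarrow> E\<^sup>\<infinity>\<^sub>p\<^sub>,\<^sub>q \<rightarrow> 0\<close>, whose first map is the inclusion.\<close>

definition matches_colim ::
  "('a, 'r) ring_scheme \<Rightarrow> ('a, 'd, 'e) couple \<Rightarrow> int \<Rightarrow>
    (bideg \<Rightarrow> (bideg \<times> 'd) set \<Rightarrow> 'e set) \<Rightarrow> bool" where
  "matches_colim R C m \<pi> \<longleftrightarrow>
     (\<forall>n<0. zero_module (colim C n)) \<and>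
     (\<forall>n\<ge>0. filt C m (-1, n + 1) = {\<zero>\<^bsub>colim C n\<^esub>} \<and> filt C m (n, 0) = carrier (colim C n) \<and>
       (\<forall>p q. 0 \<le> p \<and> 0 \<le> q \<and> p + q = n \<longrightarrow>
         filt C m (p - 1, q + 1) \<subseteq> filt C m (p, q) \<and>
         (let F = (colim C n)\<lparr>carrier := filt C m (p, q)\<rparr> in
           \<pi> (p, q) \<in> mod_hom R F (page_inf C (p, q)) \<and>
           a_kernel F (page_inf C (p, q)) (\<pi> (p, q)) = filt C m (p - 1, q + 1) \<and>
           \<pi> (p, q) ` carrier F = carrier (page_inf C (p, q)))))"

end

theory Submission
  imports Defs
begin

text \<open>The second page is controlled by its bottom row: an isomorphism on the entries \<open>(p, 0)\<close> with
  \<open>0 \<le> p \<le> n\<close> gives one on all columns \<open>p \<le> n\<close>. So the theorem is an induction on \<open>n\<close>, whose step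
  must pass from the columns \<open>p \<le> n\<close> to the single new entry \<open>(n + 1, 0)\<close>
  (\<open>page_iso_next_corner\<close>). This is a comparison argument in the style of Zeeman: what is known about
  the abutment is carried back from the \<open>\<infinity>\<close>-page to the second page.

  Going forward through the pages, the iso on the columns \<open>p \<le> n\<close> of the second page
  only survives in part, because the columns to the right of \<open>n\<close> send differentials into them: on page
  \<open>r\<close> the map is still onto in the columns \<open>p \<le> n\<close>, but one-to-one only where \<open>p \<le> n - r + 1\<close>
  (\<open>page_iso_propagates\<close>). Being onto is all that the abutment needs. By one half of the five lemma
  the map is onto on every filtration stage \<open>F\<^sub>p\<close> with \<open>p \<le> n\<close>; it is also one-to-one there, since it is
  so on the whole abutment. Therefore \<open>E\<^sup>\<infinity>\<close> is mapped isomorphically in the columns \<open>p \<le> n\<close>, and also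
  at \<open>(n + 1, 0)\<close>, where \<open>E\<^sup>\<infinity>\<close> is the quotient of the whole of \<open>L\<^sub>n\<^sub>+\<^sub>1\<close> by \<open>F\<^sub>n\<close>.

  It remains to go backward from \<open>E\<^sup>\<infinity>\<close> to \<open>E\<^sup>2\<close> at \<open>(n + 1, 0)\<close>. Nothing arrives there, so \<open>E\<^sup>r\<^sup>+\<^sup>1\<close> is the
  kernel of \<open>d\<^sup>r\<close> and there is an extension \<open>0 \<rightarrow> E\<^sup>r\<^sup>+\<^sup>1 \<rightarrow> E\<^sup>r \<rightarrow> im d\<^sup>r \<rightarrow> 0\<close>. The image of \<open>d\<^sup>r\<close> lies in
  column \<open>n + 1 - r\<close>, where the map on \<open>E\<^sup>r\<close> is an isomorphism, and it is mapped isomorphically as soon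
  as the map on \<open>E\<^sup>r\<^sup>+\<^sup>1\<close> is one-to-one at that place. The latter holds for \<open>E\<^sup>\<infinity>\<close>, and it goes back to
  \<open>E\<^sup>r\<^sup>+\<^sup>1\<close> because from that page on nothing arrives at that place either, while the differentials
  that depart from it end in columns where the map is one-to-one.

  All of this is done with representatives. A page is \<open>Z/B\<close> for submodules \<open>B \<subseteq> Z\<close> of the one
  module \<open>E\<close>, and a differential is a relation \<open>d_rel\<close> between elements of \<open>E\<close>, whose domain is
  \<open>Z\<^sup>t\<close>, whose range is \<open>B\<^sup>t\<^sup>+\<^sup>1\<close>, and in which \<open>Z\<^sup>t\<^sup>+\<^sup>1\<close> corresponds to \<open>B\<^sup>t\<close> (\<open>d_rel_boundary_iff\<close>).
  Together with additivity and naturality of \<open>d_rel\<close>, these three properties carry all passages from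
  one page to another. The index \<open>t\<close> below always belongs to the page \<open>E\<^sup>t\<^sup>+\<^sup>1 = Z\<^sup>t/B\<^sup>t\<close>.\<close>

section \<open>Left modules and their subquotients\<close>

context left_module
begin

lemma smult_zero_scalar:
  assumes "x \<in> carrier M"
  shows "\<zero>\<^bsub>R\<^esub> \<odot>\<^bsub>M\<^esub> x = \<zero>\<^bsub>M\<^esub>"
proof -
  have "\<zero>\<^bsub>R\<^esub> \<odot>\<^bsub>M\<^esub> x \<oplus>\<^bsub>M\<^esub> \<zero>\<^bsub>R\<^esub> \<odot>\<^bsub>M\<^esub> x = \<zero>\<^bsub>R\<^esub> \<odot>\<^bsub>M\<^esub> x"
    using smult_l_distr[of "\<zero>\<^bsub>R\<^esub>" "\<zero>\<^bsub>R\<^esub>" x] assms by simp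
  then show ?thesis
    using assms by (simp add: smult_closed M.add.l_cancel_one')
qed

lemma smult_minus_one:
  assumes "x \<in> carrier M"
  shows "(\<ominus>\<^bsub>R\<^esub> \<one>\<^bsub>R\<^esub>) \<odot>\<^bsub>M\<^esub> x = \<ominus>\<^bsub>M\<^esub> x"
proof -
  have "(\<ominus>\<^bsub>R\<^esub> \<one>\<^bsub>R\<^esub>) \<odot>\<^bsub>M\<^esub> x \<oplus>\<^bsub>M\<^esub> x = \<zero>\<^bsub>M\<^esub>"
    using smult_l_distr[of "\<ominus>\<^bsub>R\<^esub> \<one>\<^bsub>R\<^esub>" "\<one>\<^bsub>R\<^esub>" x] assms
    by (simp add: R.l_neg smult_one smult_zero_scalar)
  then show ?thesis
    using assms by (simp add: M.minus_equality smult_closed)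
qed

text \<open>Closure under negation comes for free, since \<open>- x = (- 1) x\<close>.\<close>
lemma submoduleI:
  assumes subset: "H \<subseteq> carrier M" and zero: "\<zero>\<^bsub>M\<^esub> \<in> H"
    and add: "\<And>x y. \<lbrakk>x \<in> H; y \<in> H\<rbrakk> \<Longrightarrow> x \<oplus>\<^bsub>M\<^esub> y \<in> H"
    and smult: "\<And>a x. \<lbrakk>a \<in> carrier R; x \<in> H\<rbrakk> \<Longrightarrow> a \<odot>\<^bsub>M\<^esub> x \<in> H"
  shows "submodule H R M"
proof -
  have neg: "\<ominus>\<^bsub>M\<^esub> x \<in> H" if "x \<in> H" for x
    using smult[of "\<ominus>\<^bsub>R\<^esub> \<one>\<^bsub>R\<^esub>" x] that subset by (auto simp: smult_minus_one)
  show ?thesis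
    by (intro submodule.intro subgroup.intro submodule_axioms.intro)
      (use assms neg in \<open>auto simp: a_inv_def\<close>)
qed

lemma submodule_closed:
  assumes "submodule H R M"
  shows "x \<in> H \<Longrightarrow> x \<in> carrier M"
    and "\<zero>\<^bsub>M\<^esub> \<in> H"
    and "\<lbrakk>x \<in> H; y \<in> H\<rbrakk> \<Longrightarrow> x \<oplus>\<^bsub>M\<^esub> y \<in> H"
    and "\<lbrakk>x \<in> H; y \<in> H\<rbrakk> \<Longrightarrow> x \<ominus>\<^bsub>M\<^esub> y \<in> H"
    and "\<lbrakk>a \<in> carrier R; x \<in> H\<rbrakk> \<Longrightarrow> a \<odot>\<^bsub>M\<^esub> x \<in> H"
proof -
  interpret submodule H R M by fact
  show "x \<in> H \<Longrightarrow> x \<in> carrier M" using mem_carrier by simp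
  show "\<zero>\<^bsub>M\<^esub> \<in> H" using one_closed by simp
  show add: "\<lbrakk>x \<in> H; y \<in> H\<rbrakk> \<Longrightarrow> x \<oplus>\<^bsub>M\<^esub> y \<in> H" for x y using m_closed by simp
  have "y \<in> H \<Longrightarrow> \<ominus>\<^bsub>M\<^esub> y \<in> H" using m_inv_closed by (simp add: a_inv_def)
  then show "\<lbrakk>x \<in> H; y \<in> H\<rbrakk> \<Longrightarrow> x \<ominus>\<^bsub>M\<^esub> y \<in> H" unfolding a_minus_def using add by blast
  show "\<lbrakk>a \<in> carrier R; x \<in> H\<rbrakk> \<Longrightarrow> a \<odot>\<^bsub>M\<^esub> x \<in> H" by (rule smult_closed)
qed

lemma submodule_abelian_subgroup:
  assumes "submodule H R M"
  shows "abelian_subgroup H M"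
proof -
  interpret submodule H R M by fact
  show ?thesis
    by (rule abelian_subgroupI3[OF additive_subgroup.intro])
      (unfold_locales)
qed

lemma minus_eq_iff_add:
  "\<lbrakk>x \<in> carrier M; y \<in> carrier M; z \<in> carrier M\<rbrakk> \<Longrightarrow> x \<ominus>\<^bsub>M\<^esub> y = z \<longleftrightarrow> x = z \<oplus>\<^bsub>M\<^esub> y"
  by (metis M.minus_eq M.a_assoc M.a_inv_closed M.l_neg M.r_neg M.r_zero)

lemma minus_add_cancel: "\<lbrakk>x \<in> carrier M; y \<in> carrier M\<rbrakk> \<Longrightarrow> (x \<ominus>\<^bsub>M\<^esub> y) \<oplus>\<^bsub>M\<^esub> y = x"
  by (rule minus_eq_iff_add[THEN iffD1, symmetric]) auto

lemma minus_eq_zero_iff: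
  "\<lbrakk>x \<in> carrier M; y \<in> carrier M\<rbrakk> \<Longrightarrow> x \<ominus>\<^bsub>M\<^esub> y = \<zero>\<^bsub>M\<^esub> \<longleftrightarrow> x = y"
  by (simp add: minus_eq_iff_add)

lemma minus_zero_right: "x \<in> carrier M \<Longrightarrow> x \<ominus>\<^bsub>M\<^esub> \<zero>\<^bsub>M\<^esub> = x"
  by (simp add: minus_eq_iff_add)

lemma minus_minus_cancel:
  "\<lbrakk>x \<in> carrier M; y \<in> carrier M\<rbrakk> \<Longrightarrow> x \<ominus>\<^bsub>M\<^esub> (x \<ominus>\<^bsub>M\<^esub> y) = y"
  by (simp add: minus_eq_iff_add M.a_comm[of y] minus_add_cancel)

lemma add_minus_cancel:
  "\<lbrakk>x \<in> carrier M; y \<in> carrier M\<rbrakk> \<Longrightarrow> (x \<oplus>\<^bsub>M\<^esub> y) \<ominus>\<^bsub>M\<^esub> x = y"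
  by (simp add: minus_eq_iff_add M.a_comm)

lemma minus_add_eq:
  "\<lbrakk>x \<in> carrier M; y \<in> carrier M; z \<in> carrier M\<rbrakk> \<Longrightarrow>
    x \<ominus>\<^bsub>M\<^esub> (y \<oplus>\<^bsub>M\<^esub> z) = (x \<ominus>\<^bsub>M\<^esub> y) \<ominus>\<^bsub>M\<^esub> z"
  by (simp add: M.minus_eq M.minus_add M.a_assoc)

lemma mem_coset_iff:
  assumes "submodule H R M" "x \<in> carrier M"
  shows "y \<in> H +>\<^bsub>M\<^esub> x \<longleftrightarrow> y \<in> carrier M \<and> y \<ominus>\<^bsub>M\<^esub> x \<in> H"
proof -
  interpret abelian_subgroup H M
    by (rule submodule_abelian_subgroup) fact
  show ?thesis
    using a_rcos_module[OF assms(2), of y] a_elemrcos_carrier[OF assms(2), of y]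
    by (auto simp: M.minus_eq)
qed

lemma coset_eq_iff:
  assumes "submodule H R M" "x \<in> carrier M" "y \<in> carrier M"
  shows "H +>\<^bsub>M\<^esub> y = H +>\<^bsub>M\<^esub> x \<longleftrightarrow> y \<ominus>\<^bsub>M\<^esub> x \<in> H"
proof -
  interpret abelian_subgroup H M
    by (rule submodule_abelian_subgroup) fact
  show ?thesis
    using mem_coset_iff[OF assms(1,2), of y] a_repr_independence'[of y x] a_repr_independenceD[of y x]
      assms(2,3) by blast
qed

lemma coset_self: "\<lbrakk>submodule H R M; x \<in> carrier M\<rbrakk> \<Longrightarrow> x \<in> H +>\<^bsub>M\<^esub> x"
  by (simp add: mem_coset_iff M.minus_eq M.r_neg submodule_closed(2))

lemma coset_eq_self_iff:
  assumes "submodule H R M" "x \<in> carrier M"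
  shows "H +>\<^bsub>M\<^esub> x = H \<longleftrightarrow> x \<in> H"
proof -
  interpret abelian_subgroup H M
    by (rule submodule_abelian_subgroup) fact
  show ?thesis using a_rcos_const[of x] coset_self[OF assms] by auto
qed

lemma coset_add:
  "\<lbrakk>submodule H R M; x \<in> carrier M; y \<in> carrier M\<rbrakk> \<Longrightarrow>
    (H +>\<^bsub>M\<^esub> x) <+>\<^bsub>M\<^esub> (H +>\<^bsub>M\<^esub> y) = H +>\<^bsub>M\<^esub> (x \<oplus>\<^bsub>M\<^esub> y)"
  by (rule abelian_subgroup.a_rcos_sum[OF submodule_abelian_subgroup])

lemma smult_minus_distr:
  assumes "a \<in> carrier R" "x \<in> carrier M" "y \<in> carrier M"
  shows "a \<odot>\<^bsub>M\<^esub> (x \<ominus>\<^bsub>M\<^esub> y) = a \<odot>\<^bsub>M\<^esub> x \<ominus>\<^bsub>M\<^esub> a \<odot>\<^bsub>M\<^esub> y"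
proof -
  have "a \<odot>\<^bsub>M\<^esub> x = a \<odot>\<^bsub>M\<^esub> (x \<ominus>\<^bsub>M\<^esub> y) \<oplus>\<^bsub>M\<^esub> a \<odot>\<^bsub>M\<^esub> y"
    using assms minus_eq_iff_add[of x y "x \<ominus>\<^bsub>M\<^esub> y"] smult_r_distr[of a "x \<ominus>\<^bsub>M\<^esub> y" y] by simp
  then show ?thesis
    using minus_eq_iff_add[of "a \<odot>\<^bsub>M\<^esub> x" "a \<odot>\<^bsub>M\<^esub> y" "a \<odot>\<^bsub>M\<^esub> (x \<ominus>\<^bsub>M\<^esub> y)"] assms
    by (simp add: smult_closed)
qed

lemma smult_zero: "a \<in> carrier R \<Longrightarrow> a \<odot>\<^bsub>M\<^esub> \<zero>\<^bsub>M\<^esub> = \<zero>\<^bsub>M\<^esub>"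
  using smult_r_distr[of a "\<zero>\<^bsub>M\<^esub>" "\<zero>\<^bsub>M\<^esub>"] by (simp add: smult_closed M.add.l_cancel_one')

text \<open>This evaluates the unions over representatives by which scalar multiplication on a subquotient
  and induced maps are given, once they are known to be well defined.\<close>
lemma UN_coset_const:
  assumes "submodule H R M" "x \<in> carrier M"
    and "\<And>y. \<lbrakk>y \<in> carrier M; y \<ominus>\<^bsub>M\<^esub> x \<in> H\<rbrakk> \<Longrightarrow> F y = F x"
  shows "(\<Union>y\<in>H +>\<^bsub>M\<^esub> x. F y) = F x"
proof -
  have "F y = F x" if "y \<in> H +>\<^bsub>M\<^esub> x" for y
    using that assms(3) unfolding mem_coset_iff[OF assms(1,2)] by blast
  with coset_self[OF assms(1,2)] show ?thesis by blast
qed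

end

lemma subquot_simps [simp]:
  "carrier (subquot M Z B) = (\<lambda>z. B +>\<^bsub>M\<^esub> z) ` Z"
  "\<zero>\<^bsub>subquot M Z B\<^esub> = B"
  "X \<oplus>\<^bsub>subquot M Z B\<^esub> Y = X <+>\<^bsub>M\<^esub> Y"
  by (simp_all add: subquot_def)

lemma subquot_smult:
  fixes M :: "('a, 'm) module"
  assumes "left_module R M" "submodule H R M" "x \<in> carrier M" "a \<in> carrier R"
  shows "a \<odot>\<^bsub>subquot M Z H\<^esub> (H +>\<^bsub>M\<^esub> x) = H +>\<^bsub>M\<^esub> (a \<odot>\<^bsub>M\<^esub> x)"
proof -
  interpret left_module R M by fact
  have "H +>\<^bsub>M\<^esub> (a \<odot>\<^bsub>M\<^esub> y) = H +>\<^bsub>M\<^esub> (a \<odot>\<^bsub>M\<^esub> x)" if "y \<in> carrier M" "y \<ominus>\<^bsub>M\<^esub> x \<in> H" for y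
    using submodule_closed(5)[OF assms(2,4) that(2)] that assms
    by (simp add: coset_eq_iff smult_closed smult_minus_distr)
  then show ?thesis
    unfolding subquot_def using UN_coset_const[OF assms(2,3), of "\<lambda>y. H +>\<^bsub>M\<^esub> (a \<odot>\<^bsub>M\<^esub> y)"] by simp
qed

lemma zero_module_subquot_iff:
  fixes M :: "('a, 'm) module"
  assumes "left_module R M" and Z: "submodule Z R M" and B: "submodule B R M" and "B \<subseteq> Z"
  shows "zero_module (subquot M Z B) \<longleftrightarrow> Z = B"
proof -
  interpret left_module R M by fact
  have "zero_module (subquot M Z B) \<longleftrightarrow> (\<lambda>z. B +>\<^bsub>M\<^esub> z) ` Z = {B}"
    by (simp add: zero_module_def)
  also have "\<dots> \<longleftrightarrow> (\<forall>z\<in>Z. B +>\<^bsub>M\<^esub> z = B)"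
    using submodule_closed(2)[OF Z] by blast
  also have "\<dots> \<longleftrightarrow> (\<forall>z\<in>Z. z \<in> B)"
    by (intro ball_cong refl coset_eq_self_iff B submodule_closed(1)[OF Z])
  finally show ?thesis using \<open>B \<subseteq> Z\<close> by blast
qed

locale linear_map = M: left_module R M + N: left_module R N
  for R (structure) and M :: "('a, 'm) module" and N :: "('a, 'n) module" +
  fixes h
  assumes hom: "h \<in> mod_hom R M N"
begin

lemma closed [simp]: "x \<in> carrier M \<Longrightarrow> h x \<in> carrier N"
  using hom by (simp add: mod_hom_def Pi_iff)

lemma add: "\<lbrakk>x \<in> carrier M; y \<in> carrier M\<rbrakk> \<Longrightarrow> h (x \<oplus>\<^bsub>M\<^esub> y) = h x \<oplus>\<^bsub>N\<^esub> h y"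
  using hom by (simp add: mod_hom_def)

lemma smult: "\<lbrakk>a \<in> carrier R; x \<in> carrier M\<rbrakk> \<Longrightarrow> h (a \<odot>\<^bsub>M\<^esub> x) = a \<odot>\<^bsub>N\<^esub> h x"
  using hom by (simp add: mod_hom_def)

lemma zero: "h \<zero>\<^bsub>M\<^esub> = \<zero>\<^bsub>N\<^esub>"
  using smult[OF M.R.zero_closed M.zero_closed] M.smult_zero_scalar[OF M.zero_closed]
    N.smult_zero_scalar[OF closed[OF M.zero_closed]] by metis

lemma minus: "\<lbrakk>x \<in> carrier M; y \<in> carrier M\<rbrakk> \<Longrightarrow> h (x \<ominus>\<^bsub>M\<^esub> y) = h x \<ominus>\<^bsub>N\<^esub> h y"
  using add[of "x \<ominus>\<^bsub>M\<^esub> y" y] M.minus_add_cancel[of x y]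
    N.minus_eq_iff_add[of "h x" "h y" "h (x \<ominus>\<^bsub>M\<^esub> y)"] by simp

lemma mem_kernel: "x \<in> a_kernel M N h \<longleftrightarrow> x \<in> carrier M \<and> h x = \<zero>\<^bsub>N\<^esub>"
  by (simp add: a_kernel_def')

lemma submodule_image:
  assumes "submodule H R M"
  shows "submodule (h ` H) R N"
proof (rule N.submoduleI)
  note H = M.submodule_closed[OF assms]
  show "h ` H \<subseteq> carrier N" using H(1) closed by blast
  show "\<zero>\<^bsub>N\<^esub> \<in> h ` H" using imageI[OF H(2), of h] by (simp only: zero)
  fix u v assume "u \<in> h ` H" "v \<in> h ` H"
  then obtain x y where xy: "x \<in> H" "y \<in> H" "u = h x" "v = h y" by blast
  then show "u \<oplus>\<^bsub>N\<^esub> v \<in> h ` H"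
    using imageI[OF H(3)[OF xy(1,2)], of h] by (simp only: add H(1))
next
  note H = M.submodule_closed[OF assms]
  fix a u assume a: "a \<in> carrier R" and "u \<in> h ` H"
  then obtain x where x: "x \<in> H" "u = h x" by blast
  show "a \<odot>\<^bsub>N\<^esub> u \<in> h ` H"
    using imageI[OF H(5)[OF a x(1)], of h] by (simp only: x smult a H(1))
qed

lemma submodule_vimage:
  assumes "submodule H R N"
  shows "submodule {x \<in> carrier M. h x \<in> H} R M"
proof (rule M.submoduleI)
  note H = N.submodule_closed[OF assms]
  show "\<zero>\<^bsub>M\<^esub> \<in> {x \<in> carrier M. h x \<in> H}" by (simp add: zero H(2))
  show "x \<oplus>\<^bsub>M\<^esub> y \<in> {x \<in> carrier M. h x \<in> H}"
    if "x \<in> {x \<in> carrier M. h x \<in> H}" "y \<in> {x \<in> carrier M. h x \<in> H}" for x y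
    using that by (simp add: add H(3))
  show "a \<odot>\<^bsub>M\<^esub> x \<in> {x \<in> carrier M. h x \<in> H}"
    if "a \<in> carrier R" "x \<in> {x \<in> carrier M. h x \<in> H}" for a x
    using that by (simp add: smult H(5) M.smult_closed)
qed blast

lemma submodule_kernel: "submodule (a_kernel M N h) R M"
proof -
  have "submodule {\<zero>\<^bsub>N\<^esub>} R N"
    by (rule N.submoduleI) (simp_all add: N.smult_zero)
  from submodule_vimage[OF this] show ?thesis by (simp add: a_kernel_def')
qed

lemma submodule_carrier: "submodule (carrier M) R M"
  by (rule M.submoduleI) (simp_all add: M.smult_closed)

lemma quot_map_coset:
  assumes "submodule B R M" "submodule B' R N" "h ` B \<subseteq> B'" "x \<in> carrier M"
  shows "quot_map N B' h (B +>\<^bsub>M\<^esub> x) = B' +>\<^bsub>N\<^esub> h x"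
  unfolding quot_map_def
proof (rule M.UN_coset_const[OF assms(1,4)])
  fix y assume "y \<in> carrier M" "y \<ominus>\<^bsub>M\<^esub> x \<in> B"
  then have "h y \<ominus>\<^bsub>N\<^esub> h x \<in> B'"
    using assms(3,4) by (auto simp flip: minus)
  then show "B' +>\<^bsub>N\<^esub> h y = B' +>\<^bsub>N\<^esub> h x"
    using N.coset_eq_iff[OF assms(2)] \<open>y \<in> carrier M\<close> assms(4) by simp
qed

lemma quot_map_hom:
  assumes sub: "submodule Z R M" "submodule B R M" "submodule B' R N"
    and maps: "h ` Z \<subseteq> Z'" "h ` B \<subseteq> B'"
  shows "quot_map N B' h \<in> mod_hom R (subquot M Z B) (subquot N Z' B')" (is "?q \<in> _")
proof -
  note Z = M.submodule_closed(1)[OF sub(1)]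
  note q = quot_map_coset[OF sub(2,3) maps(2)]
  have "?q (B +>\<^bsub>M\<^esub> x) \<in> (\<lambda>z. B' +>\<^bsub>N\<^esub> z) ` Z'" if "x \<in> Z" for x
    using that maps(1) by (auto simp: q Z)
  moreover have "?q ((B +>\<^bsub>M\<^esub> x) <+>\<^bsub>M\<^esub> (B +>\<^bsub>M\<^esub> y)) =
      ?q (B +>\<^bsub>M\<^esub> x) <+>\<^bsub>N\<^esub> ?q (B +>\<^bsub>M\<^esub> y)" if "x \<in> Z" "y \<in> Z" for x y
    using that[THEN Z] by (simp add: q M.coset_add[OF sub(2)] N.coset_add[OF sub(3)] add)
  moreover have "?q (a \<odot>\<^bsub>subquot M Z B\<^esub> (B +>\<^bsub>M\<^esub> x)) =
      a \<odot>\<^bsub>subquot N Z' B'\<^esub> ?q (B +>\<^bsub>M\<^esub> x)" if "a \<in> carrier R" "x \<in> Z" for a x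
    using that(1) Z[OF that(2)]
    by (simp add: q subquot_smult[OF M.left_module_axioms sub(2)]
        subquot_smult[OF N.left_module_axioms sub(3)] smult M.smult_closed)
  ultimately show ?thesis
    unfolding mod_hom_def by auto
qed

text \<open>Whether the induced map of subquotients is an isomorphism can be decided on representatives:
  the first condition is surjectivity, the second is triviality of the kernel.\<close>
lemma quot_map_iso_iff:
  assumes sub: "submodule Z R M" "submodule B R M" "submodule Z' R N" "submodule B' R N"
    and maps: "h ` Z \<subseteq> Z'" "h ` B \<subseteq> B'"
  shows "quot_map N B' h \<in> mod_iso R (subquot M Z B) (subquot N Z' B') \<longleftrightarrow>
    (\<forall>e'\<in>Z'. \<exists>e\<in>Z. e' \<ominus>\<^bsub>N\<^esub> h e \<in> B') \<and> (\<forall>e\<in>Z. h e \<in> B' \<longrightarrow> e \<in> B)"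
proof -
  note Z = M.submodule_closed[OF sub(1)] and Z' = N.submodule_closed(1)[OF sub(3)]
  note q = quot_map_coset[OF sub(2,4) maps(2)]
  have img: "quot_map N B' h ` carrier (subquot M Z B) = (\<lambda>z. B' +>\<^bsub>N\<^esub> h z) ` Z"
    using Z(1) by (simp add: q image_image)
  have surj: "quot_map N B' h ` carrier (subquot M Z B) = carrier (subquot N Z' B') \<longleftrightarrow>
      (\<forall>e'\<in>Z'. \<exists>e\<in>Z. e' \<ominus>\<^bsub>N\<^esub> h e \<in> B')" (is "?L \<longleftrightarrow> ?R")
  proof -
    have aux: "A = A' \<longleftrightarrow> A' \<subseteq> A" if "A \<subseteq> A'" for A A' :: "'n set set"
      using that by blast
    have "?L \<longleftrightarrow> (\<lambda>z. B' +>\<^bsub>N\<^esub> h z) ` Z = (\<lambda>z. B' +>\<^bsub>N\<^esub> z) ` Z'"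
      by (simp only: img subquot_simps(1)[of N])
    also have "\<dots> \<longleftrightarrow> (\<lambda>z. B' +>\<^bsub>N\<^esub> z) ` Z' \<subseteq> (\<lambda>z. B' +>\<^bsub>N\<^esub> h z) ` Z"
      by (rule aux) (use maps(1) in \<open>simp add: image_subset_iff\<close>)
    also have "\<dots> \<longleftrightarrow> (\<forall>e'\<in>Z'. \<exists>e\<in>Z. B' +>\<^bsub>N\<^esub> e' = B' +>\<^bsub>N\<^esub> h e)"
      by (simp only: image_subset_iff image_iff)
    also have "\<dots> \<longleftrightarrow> ?R"
      using Z(1) Z' by (simp add: N.coset_eq_iff[OF sub(4)] cong: ball_cong bex_cong)
    finally show ?thesis .
  qed
  have inj: "inj_on (quot_map N B' h) (carrier (subquot M Z B)) \<longleftrightarrow>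
      (\<forall>e\<in>Z. h e \<in> B' \<longrightarrow> e \<in> B)" (is "?L \<longleftrightarrow> ?R")
  proof -
    have "?L \<longleftrightarrow> (\<forall>u\<in>Z. \<forall>v\<in>Z. B' +>\<^bsub>N\<^esub> h u = B' +>\<^bsub>N\<^esub> h v \<longrightarrow> B +>\<^bsub>M\<^esub> u = B +>\<^bsub>M\<^esub> v)"
      unfolding inj_on_def using Z(1) by (simp add: q)
    also have "\<dots> \<longleftrightarrow> (\<forall>u\<in>Z. \<forall>v\<in>Z. h (u \<ominus>\<^bsub>M\<^esub> v) \<in> B' \<longrightarrow> u \<ominus>\<^bsub>M\<^esub> v \<in> B)"
      using Z(1) by (simp add: M.coset_eq_iff[OF sub(2)] N.coset_eq_iff[OF sub(4)] minus)
    also have "\<dots> \<longleftrightarrow> ?R"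
    proof
      assume *: "\<forall>u\<in>Z. \<forall>v\<in>Z. h (u \<ominus>\<^bsub>M\<^esub> v) \<in> B' \<longrightarrow> u \<ominus>\<^bsub>M\<^esub> v \<in> B"
      show ?R
      proof (intro ballI impI)
        fix u assume "u \<in> Z" "h u \<in> B'"
        with *[rule_format, OF _ Z(2), of u] show "u \<in> B"
          by (simp add: M.minus_zero_right Z(1))
      qed
    qed (use Z(4) in blast)
    finally show ?thesis .
  qed
  show ?thesis
    unfolding mod_iso_def bij_betw_def using quot_map_hom[OF sub(1,2,4) maps] surj inj
    by (simp add: conj_commute)
qed

end

section \<open>Cycles, boundaries and the differentials of an exact couple\<close>

lemma zscale_add: "zscale (s + t) a = zscale s a + zscale t a"
  by (simp add: zscale_def algebra_simps)

lemma zscale_zero [simp]: "zscale 0 a = 0"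
  by (simp add: zscale_def zero_prod_def)

lemma zscale_one [simp]: "zscale 1 a = a"
  by (simp add: zscale_def)

lemma zscale_Suc: "zscale (1 + int r) a = zscale (int r) a + a"
  by (simp add: zscale_add add.commute)

lemma ipow_add:
  "ipow C (r + s) x d = ipow C s (x + zscale (int r) (ideg C)) (ipow C r x d)"
  by (induction s) (simp_all add: zscale_add add.assoc)

lemma ipow_Suc_start: "ipow C (Suc r) x d = ipow C r (x + ideg C) (imap C x d)"
  using ipow_add[of C 1 r x d] by simp

lemma mod_hom_compose:
  "\<lbrakk>h \<in> mod_hom R M N; k \<in> mod_hom R N P\<rbrakk> \<Longrightarrow> (\<lambda>x. k (h x)) \<in> mod_hom R M P"
  by (simp add: mod_hom_def Pi_iff)

text \<open>The position of the elements \<open>y\<close> with \<open>i\<^sup>t y = k e\<close>, for \<open>e\<close> at position \<open>x\<close>.\<close>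
definition lift_pos :: "('a, 'd, 'e) couple \<Rightarrow> nat \<Rightarrow> bideg \<Rightarrow> bideg" where
  "lift_pos C t x = x + kdeg C - zscale (int t) (ideg C)"

lemma lift_pos_add [simp]: "lift_pos C t x + zscale (int t) (ideg C) = x + kdeg C"
  and lift_pos_add_jdeg [simp]: "lift_pos C t x + jdeg C = x + diff_deg C (Suc t)"
  and lift_pos_diff: "lift_pos C t x - ideg C = lift_pos C (Suc t) x"
  and lift_pos_Suc_add [simp]: "lift_pos C (Suc t) x + ideg C = lift_pos C t x"
  by (simp_all add: lift_pos_def diff_deg_def zscale_Suc algebra_simps)

lemma lift_pos_eq: "z - jdeg C = lift_pos C t (z - diff_deg C (Suc t))"
  by (simp add: lift_pos_def diff_deg_def algebra_simps)

text \<open>The differential of the page \<open>E\<^sup>t\<^sup>+\<^sup>1\<close> as an additive relation on \<open>E\<close>: \<open>b = j y\<close> for some \<open>y\<close> with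
  \<open>i\<^sup>t y = k e\<close>. Different choices of \<open>y\<close> give elements \<open>b\<close> that differ by \<open>B\<^sup>t\<close>.\<close>
definition d_rel :: "('a, 'd, 'e) couple \<Rightarrow> nat \<Rightarrow> bideg \<Rightarrow> 'e \<Rightarrow> 'e \<Rightarrow> bool" where
  "d_rel C t x e b \<longleftrightarrow> e \<in> carrier (obE C x) \<and>
     (\<exists>y\<in>carrier (obD C (lift_pos C t x)).
        ipow C t (lift_pos C t x) y = kmap C x e \<and> b = jmap C (lift_pos C t x) y)"

context exact_couple
begin

sublocale D: left_module R "obD C x" for x
  by (rule module_D)

sublocale E: left_module R "obE C x" for x
  by (rule module_E)

sublocale i: linear_map R "obD C x" "obD C (x + ideg C)" "imap C x" for x
  by (intro linear_map.intro linear_map_axioms.intro module_D hom_i)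

sublocale j: linear_map R "obD C x" "obE C (x + jdeg C)" "jmap C x" for x
  by (intro linear_map.intro linear_map_axioms.intro module_D module_E hom_j)

sublocale k: linear_map R "obE C x" "obD C (x + kdeg C)" "kmap C x" for x
  by (intro linear_map.intro linear_map_axioms.intro module_D module_E hom_k)

sublocale ip: linear_map R "obD C x" "obD C (x + zscale (int r) (ideg C))" "ipow C r x" for r x
proof (intro linear_map.intro linear_map_axioms.intro module_D)
  show "ipow C r x \<in> mod_hom R (obD C x) (obD C (x + zscale (int r) (ideg C)))"
  proof (induction r)
    case 0
    show ?case by (simp add: mod_hom_def)
  next
    case (Suc r)
    show ?case
      using mod_hom_compose[OF Suc hom_i] by (simp add: zscale_Suc add.assoc)
  qed
qed

lemma j_zero_iff:
  assumes "d \<in> carrier (obD C x)"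
  shows "jmap C x d = \<zero>\<^bsub>obE C (x + jdeg C)\<^esub> \<longleftrightarrow>
    (\<exists>y\<in>carrier (obD C (x - ideg C)). d = imap C (x - ideg C) y)"
  using exact_ij[of x] assms by (auto simp: set_eq_iff j.mem_kernel)

lemma k_zero_iff:
  assumes "e \<in> carrier (obE C x)"
  shows "kmap C x e = \<zero>\<^bsub>obD C (x + kdeg C)\<^esub> \<longleftrightarrow>
    (\<exists>d\<in>carrier (obD C (x - jdeg C)). e = jmap C (x - jdeg C) d)"
  using exact_jk[of "x - jdeg C"] assms by (auto simp: set_eq_iff k.mem_kernel)

lemma i_zero_iff:
  assumes "d \<in> carrier (obD C x)"
  shows "imap C x d = \<zero>\<^bsub>obD C (x + ideg C)\<^esub> \<longleftrightarrow>
    (\<exists>e\<in>carrier (obE C (x - kdeg C)). d = kmap C (x - kdeg C) e)"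
  using exact_ki[of "x - jdeg C - kdeg C"] assms by (auto simp: set_eq_iff i.mem_kernel)

lemma mem_cycles:
  "e \<in> cycles C t x \<longleftrightarrow> e \<in> carrier (obE C x) \<and>
    (\<exists>y\<in>carrier (obD C (lift_pos C t x)). ipow C t (lift_pos C t x) y = kmap C x e)"
  by (auto simp: cycles_def lift_pos_def Let_def image_iff eq_commute[of "kmap C x e"])

lemma mem_cycles_iff_d_rel: "e \<in> cycles C t x \<longleftrightarrow> (\<exists>b. d_rel C t x e b)"
  by (auto simp: mem_cycles d_rel_def)

lemma mem_boundaries:
  "b \<in> boundaries C t x \<longleftrightarrow> (\<exists>y\<in>carrier (obD C (x - jdeg C)).
     ipow C t (x - jdeg C) y = \<zero>\<^bsub>obD C (x - jdeg C + zscale (int t) (ideg C))\<^esub> \<and> b = jmap C (x - jdeg C) y)"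
  unfolding boundaries_def Let_def by (auto simp: ip.mem_kernel)

lemma submodule_cycles: "submodule (cycles C t x) R (obE C x)"
proof -
  have "submodule (ipow C t (lift_pos C t x) ` carrier (obD C (lift_pos C t x))) R (obD C (x + kdeg C))"
    using ip.submodule_image[OF ip.submodule_carrier, of t "lift_pos C t x"] by simp
  from k.submodule_vimage[OF this] show ?thesis
    by (simp add: cycles_def lift_pos_def Let_def)
qed

lemma submodule_boundaries: "submodule (boundaries C t x) R (obE C x)"
  using j.submodule_image[OF ip.submodule_kernel, of "x - jdeg C" t]
  by (simp add: boundaries_def Let_def)

text \<open>Boundaries are in the image of \<open>j\<close> and hence are killed by \<open>k\<close>, so they are cycles for every page.\<close>
lemma boundaries_subset_cycles: "boundaries C s x \<subseteq> cycles C t x"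
proof
  fix b assume "b \<in> boundaries C s x"
  then obtain y where y: "y \<in> carrier (obD C (x - jdeg C))" "b = jmap C (x - jdeg C) y"
    by (auto simp: mem_boundaries)
  then have b: "b \<in> carrier (obE C x)" using j.closed[OF y(1)] by simp
  then have "kmap C x b = \<zero>\<^bsub>obD C (x + kdeg C)\<^esub>" using y by (auto simp: k_zero_iff)
  then show "b \<in> cycles C t x"
    using b ip.zero[of t "lift_pos C t x"] by (auto simp: mem_cycles intro!: bexI[of _ "\<zero>\<^bsub>obD C (lift_pos C t x)\<^esub>"])
qed

lemma cycles_Suc_subset: "cycles C (Suc t) x \<subseteq> cycles C t x"
proof
  fix e assume "e \<in> cycles C (Suc t) x"
  then obtain y where y: "y \<in> carrier (obD C (lift_pos C (Suc t) x))"
      "ipow C (Suc t) (lift_pos C (Suc t) x) y = kmap C x e" and e: "e \<in> carrier (obE C x)"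
    by (auto simp: mem_cycles simp del: ipow.simps)
  then show "e \<in> cycles C t x"
    using i.closed[OF y(1)] by (auto simp: mem_cycles ipow_Suc_start simp del: ipow.simps
      intro!: bexI[of _ "imap C (lift_pos C (Suc t) x) y"])
qed

lemma boundaries_subset_Suc: "boundaries C t x \<subseteq> boundaries C (Suc t) x"
proof
  fix b assume "b \<in> boundaries C t x"
  then obtain y where y: "y \<in> carrier (obD C (x - jdeg C))"
      "ipow C t (x - jdeg C) y = \<zero>\<^bsub>obD C (x - jdeg C + zscale (int t) (ideg C))\<^esub>"
      "b = jmap C (x - jdeg C) y"
    by (auto simp: mem_boundaries)
  then have "ipow C (Suc t) (x - jdeg C) y = \<zero>\<^bsub>obD C (x - jdeg C + zscale (int (Suc t)) (ideg C))\<^esub>"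
    by (simp add: i.zero zscale_Suc add.assoc)
  with y show "b \<in> boundaries C (Suc t) x"
    unfolding mem_boundaries by blast
qed

lemma d_rel_closed:
  "d_rel C t x e b \<Longrightarrow> e \<in> carrier (obE C x)"
  "d_rel C t x e b \<Longrightarrow> b \<in> carrier (obE C (x + diff_deg C (Suc t)))"
  using j.closed[of _ "lift_pos C t x"] by (auto simp: d_rel_def)

lemma d_rel_minus:
  assumes "d_rel C t x e b" "d_rel C t x e' b'"
  shows "d_rel C t x (e \<ominus>\<^bsub>obE C x\<^esub> e') (b \<ominus>\<^bsub>obE C (x + diff_deg C (Suc t))\<^esub> b')"
proof -
  let ?w = "lift_pos C t x"
  obtain y y' where y: "y \<in> carrier (obD C ?w)" "y' \<in> carrier (obD C ?w)"
      "ipow C t ?w y = kmap C x e" "b = jmap C ?w y" "ipow C t ?w y' = kmap C x e'" "b' = jmap C ?w y'"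
    and e: "e \<in> carrier (obE C x)" "e' \<in> carrier (obE C x)"
    using assms by (auto simp: d_rel_def)
  show ?thesis
    unfolding d_rel_def
    using y e j.minus[OF y(1,2)] ip.minus[OF y(1,2), of t]
    by (auto simp: k.minus intro!: bexI[of _ "y \<ominus>\<^bsub>obD C ?w\<^esub> y'"])
qed

text \<open>By exactness at \<open>D\<close> between \<open>k\<close> and \<open>i\<close>, an element \<open>y\<close> is killed by \<open>i\<^sup>t\<^sup>+\<^sup>1\<close> if and only if
  \<open>i\<^sup>t y = k e\<close> for some \<open>e\<close>.\<close>
lemma boundaries_Suc_iff_d_rel:
  "b \<in> boundaries C (Suc t) (x + diff_deg C (Suc t)) \<longleftrightarrow> (\<exists>e. d_rel C t x e b)"
proof -
  let ?w = "lift_pos C t x"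
  have w: "x + diff_deg C (Suc t) - jdeg C = ?w"
    using lift_pos_eq[of "x + diff_deg C (Suc t)" C t] by simp
  have "(ipow C (Suc t) ?w y = \<zero>\<^bsub>obD C (?w + zscale (int (Suc t)) (ideg C))\<^esub>) \<longleftrightarrow>
      (\<exists>e\<in>carrier (obE C x). ipow C t ?w y = kmap C x e)" if "y \<in> carrier (obD C ?w)" for y
    using i_zero_iff[OF ip.closed[OF that, of t]] by (simp add: zscale_Suc flip: add.assoc)
  then have "b \<in> boundaries C (Suc t) (x + diff_deg C (Suc t)) \<longleftrightarrow>
      (\<exists>y\<in>carrier (obD C ?w). (\<exists>e\<in>carrier (obE C x). ipow C t ?w y = kmap C x e) \<and> b = jmap C ?w y)"
    unfolding mem_boundaries w by (simp cong: bex_cong del: ipow.simps of_nat_Suc)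
  then show ?thesis
    unfolding d_rel_def by blast
qed

text \<open>Both conditions say that the element \<open>y\<close> with \<open>i\<^sup>t y = k e\<close> and \<open>b = j y\<close> is the sum of an element
  of the image of \<open>i\<close> and one of the kernel of \<open>i\<^sup>t\<close>. Hence \<open>d_rel\<close> induces an isomorphism \<open>Z\<^sup>t/Z\<^sup>t\<^sup>+\<^sup>1 \<cong> B\<^sup>t\<^sup>+\<^sup>1/B\<^sup>t\<close>.\<close>
lemma d_rel_boundary_iff:
  assumes "d_rel C t x e b"
  shows "b \<in> boundaries C t (x + diff_deg C (Suc t)) \<longleftrightarrow> e \<in> cycles C (Suc t) x"
proof -
  let ?w = "lift_pos C t x" and ?v = "lift_pos C (Suc t) x"
  obtain y where y: "y \<in> carrier (obD C ?w)" "ipow C t ?w y = kmap C x e" "b = jmap C ?w y"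
    and e: "e \<in> carrier (obE C x)"
    using assms by (auto simp: d_rel_def)
  have w: "x + diff_deg C (Suc t) - jdeg C = ?w"
    using lift_pos_eq[of "x + diff_deg C (Suc t)" C t] by simp
  have v: "?w - ideg C = ?v" by (rule lift_pos_diff)
  show ?thesis
  proof
    assume "b \<in> boundaries C t (x + diff_deg C (Suc t))"
    then obtain y' where y': "y' \<in> carrier (obD C ?w)"
        "ipow C t ?w y' = \<zero>\<^bsub>obD C (x + kdeg C)\<^esub>" "b = jmap C ?w y'"
      unfolding mem_boundaries w by auto
    have "jmap C ?w (y \<ominus>\<^bsub>obD C ?w\<^esub> y') = \<zero>\<^bsub>obE C (?w + jdeg C)\<^esub>"
      using j.minus[OF y(1) y'(1)] y(3) y'(3) d_rel_closed(2)[OF assms] by (simp add: E.minus_eq_zero_iff)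
    then obtain u where u: "u \<in> carrier (obD C ?v)" "y \<ominus>\<^bsub>obD C ?w\<^esub> y' = imap C ?v u"
      using j_zero_iff[of "y \<ominus>\<^bsub>obD C ?w\<^esub> y'" ?w] y(1) y'(1) unfolding v by auto
    have "ipow C t ?w (y \<ominus>\<^bsub>obD C ?w\<^esub> y') = kmap C x e"
      using ip.minus[OF y(1) y'(1), of t] y(2) y'(2) k.closed[OF e] by (simp add: D.minus_eq_iff_add)
    then have "ipow C (Suc t) ?v u = kmap C x e"
      by (simp add: ipow_Suc_start u(2) del: ipow.simps)
    with u(1) e show "e \<in> cycles C (Suc t) x"
      unfolding mem_cycles by blast
  next
    assume "e \<in> cycles C (Suc t) x"
    then obtain u where u: "u \<in> carrier (obD C ?v)" "ipow C (Suc t) ?v u = kmap C x e"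
      unfolding mem_cycles by blast
    have iu: "imap C ?v u \<in> carrier (obD C ?w)" using i.closed[OF u(1)] by simp
    have "ipow C t ?w (imap C ?v u) = kmap C x e"
      using u(2) by (simp add: ipow_Suc_start del: ipow.simps)
    then have "ipow C t ?w (y \<ominus>\<^bsub>obD C ?w\<^esub> imap C ?v u) = \<zero>\<^bsub>obD C (x + kdeg C)\<^esub>"
      using ip.minus[OF y(1) iu, of t] y(2) k.closed[OF e] by (simp add: D.minus_eq_zero_iff)
    moreover have "jmap C ?w (imap C ?v u) = \<zero>\<^bsub>obE C (x + diff_deg C (Suc t))\<^esub>"
      using j_zero_iff[OF iu] u(1) unfolding v by auto
    then have "b = jmap C ?w (y \<ominus>\<^bsub>obD C ?w\<^esub> imap C ?v u)"
      using j.minus[OF y(1) iu] y(3) d_rel_closed(2)[OF assms] by (simp add: E.minus_zero_right)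
    ultimately show "b \<in> boundaries C t (x + diff_deg C (Suc t))"
      unfolding mem_boundaries w using y(1) iu by auto
  qed
qed

end

section \<open>The morphism of spectral sequences\<close>

lemma page_Suc: "page C (Suc t) x = subquot (obE C x) (cycles C t x) (boundaries C t x)"
  by (simp add: page_def)

context exact_couple
begin

lemma d_rel_coset_unique:
  assumes "d_rel C t x e b" "d_rel C t x e' b'"
    and "e' \<ominus>\<^bsub>obE C x\<^esub> e \<in> boundaries C t x"
  shows "boundaries C t (x + diff_deg C (Suc t)) +>\<^bsub>obE C (x + diff_deg C (Suc t))\<^esub> b' =
    boundaries C t (x + diff_deg C (Suc t)) +>\<^bsub>obE C (x + diff_deg C (Suc t))\<^esub> b"
proof -
  have "e' \<ominus>\<^bsub>obE C x\<^esub> e \<in> cycles C (Suc t) x"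
    using assms(3) boundaries_subset_cycles by blast
  with d_rel_boundary_iff[OF d_rel_minus[OF assms(2,1)]] show ?thesis
    using assms(1,2) by (simp add: E.coset_eq_iff[OF submodule_boundaries] d_rel_closed(2))
qed

lemma diff_coset:
  assumes e: "d_rel C t x e b"
  shows "diff C (Suc t) x (boundaries C t x +>\<^bsub>obE C x\<^esub> e) =
    boundaries C t (x + diff_deg C (Suc t)) +>\<^bsub>obE C (x + diff_deg C (Suc t))\<^esub> b"
proof -
  let ?X = "boundaries C t x +>\<^bsub>obE C x\<^esub> e" and ?x' = "x + diff_deg C (Suc t)"
  let ?S = "{boundaries C t ?x' +>\<^bsub>obE C ?x'\<^esub> b' | e' b'. e' \<in> ?X \<and> d_rel C t x e' b'}"
  have X: "e' \<in> ?X \<longleftrightarrow> e' \<in> carrier (obE C x) \<and> e' \<ominus>\<^bsub>obE C x\<^esub> e \<in> boundaries C t x" for e'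
    by (rule E.mem_coset_iff[OF submodule_boundaries d_rel_closed(1)[OF e]])
  have "diff C (Suc t) x ?X = \<Union>?S"
    unfolding diff_def Let_def diff_Suc_1 of_nat_Suc add_diff_cancel_left' lift_pos_def[symmetric]
      lift_pos_add_jdeg d_rel_def
    by (rule arg_cong[of _ _ Union]) (use X in blast)
  also have "?S = {boundaries C t ?x' +>\<^bsub>obE C ?x'\<^esub> b}"
  proof
    show "?S \<subseteq> {boundaries C t ?x' +>\<^bsub>obE C ?x'\<^esub> b}"
      using d_rel_coset_unique[OF e] X by blast
    show "{boundaries C t ?x' +>\<^bsub>obE C ?x'\<^esub> b} \<subseteq> ?S"
      using e E.coset_self[OF submodule_boundaries d_rel_closed(1)[OF e]] by blast
  qed
  finally show ?thesis by simp
qed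

text \<open>In \<open>E\<^sup>t\<^sup>+\<^sup>1 = Z\<^sup>t/B\<^sup>t\<close> the image of the differential is \<open>B\<^sup>t\<^sup>+\<^sup>1/B\<^sup>t\<close>, as \<open>B\<^sup>t\<^sup>+\<^sup>1\<close> is the range of \<open>d_rel\<close>.\<close>
lemma diff_image_eq:
  "diff_image C (Suc t) x = (\<lambda>b. boundaries C t x +>\<^bsub>obE C x\<^esub> b) ` boundaries C (Suc t) x"
    (is "_ = ?B ` _")
proof -
  let ?w = "x - diff_deg C (Suc t)"
  have b: "b \<in> boundaries C (Suc t) x \<longleftrightarrow> (\<exists>e. d_rel C t ?w e b)" for b
    using boundaries_Suc_iff_d_rel[of b t ?w] by simp
  have diff: "diff C (Suc t) ?w (boundaries C t ?w +>\<^bsub>obE C ?w\<^esub> e) = ?B b" if "d_rel C t ?w e b" for e b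
    using diff_coset[OF that] by simp
  have "diff_image C (Suc t) x =
      (\<lambda>e. diff C (Suc t) ?w (boundaries C t ?w +>\<^bsub>obE C ?w\<^esub> e)) ` cycles C t ?w"
    by (simp add: diff_image_def page_Suc image_image)
  also have "\<dots> = ?B ` boundaries C (Suc t) x"
  proof (intro equalityI subsetI; elim imageE)
    fix X e assume "X = diff C (Suc t) ?w (boundaries C t ?w +>\<^bsub>obE C ?w\<^esub> e)" "e \<in> cycles C t ?w"
    then obtain b where "d_rel C t ?w e b" "X = ?B b"
      unfolding mem_cycles_iff_d_rel using diff by blast
    then show "X \<in> ?B ` boundaries C (Suc t) x" using b by blast
  next
    fix X c assume "X = ?B c" "c \<in> boundaries C (Suc t) x"
    then obtain e where e: "d_rel C t ?w e c" using b by blast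
    then have "e \<in> cycles C t ?w" unfolding mem_cycles_iff_d_rel by blast
    then show "X \<in> (\<lambda>e. diff C (Suc t) ?w (boundaries C t ?w +>\<^bsub>obE C ?w\<^esub> e)) ` cycles C t ?w"
      using \<open>X = ?B c\<close> diff[OF e] by (intro image_eqI[of _ _ e]) simp_all
  qed
  finally show ?thesis .
qed

text \<open>A homology class is a set of cosets of \<open>B\<^sup>t\<close>. It consists of those that make up the coset of
  \<open>e\<close> modulo \<open>B\<^sup>t\<^sup>+\<^sup>1\<close>, which shows that it only depends on the latter.\<close>
lemma homology_coset:
  assumes e: "e \<in> carrier (obE C x)"
  shows "diff_image C (Suc t) x +>\<^bsub>page C (Suc t) x\<^esub> (boundaries C t x +>\<^bsub>obE C x\<^esub> e) =
    (\<lambda>u. boundaries C t x +>\<^bsub>obE C x\<^esub> u) ` (boundaries C (Suc t) x +>\<^bsub>obE C x\<^esub> e)"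
proof -
  have "(boundaries C t x +>\<^bsub>obE C x\<^esub> b) <+>\<^bsub>obE C x\<^esub> (boundaries C t x +>\<^bsub>obE C x\<^esub> e) =
      boundaries C t x +>\<^bsub>obE C x\<^esub> (b \<oplus>\<^bsub>obE C x\<^esub> e)" if "b \<in> boundaries C (Suc t) x" for b
    using E.submodule_closed(1)[OF submodule_boundaries that] e by (rule E.coset_add[OF submodule_boundaries])
  then show ?thesis
    unfolding a_r_coset_def'[of "page C (Suc t) x"] a_r_coset_def'[of "obE C x" "boundaries C (Suc t) x"]
    by (simp add: diff_image_eq page_Suc image_UN cong: SUP_cong_simp)
qed

lemma page_to_homology_coset:
  assumes e: "e \<in> cycles C (Suc t) x"
  shows "page_to_homology C (Suc t) x (boundaries C (Suc t) x +>\<^bsub>obE C x\<^esub> e) =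
    (\<lambda>u. boundaries C t x +>\<^bsub>obE C x\<^esub> u) ` (boundaries C (Suc t) x +>\<^bsub>obE C x\<^esub> e)"
proof -
  let ?H = "\<lambda>z. diff_image C (Suc t) x +>\<^bsub>page C (Suc t) x\<^esub> (boundaries C t x +>\<^bsub>obE C x\<^esub> z)"
  have e: "e \<in> carrier (obE C x)" using e E.submodule_closed(1)[OF submodule_cycles] by blast
  have "?H z = ?H e" if "z \<in> carrier (obE C x)" "z \<ominus>\<^bsub>obE C x\<^esub> e \<in> boundaries C (Suc t) x" for z
    using that e E.coset_eq_iff[OF submodule_boundaries e that(1), of "Suc t"] by (simp add: homology_coset)
  then show ?thesis
    unfolding page_to_homology_def quot_map_def diff_Suc_1
    using E.UN_coset_const[OF submodule_boundaries e, of "Suc t" ?H] homology_coset[OF e, of t] by simp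
qed

lemma zero_page_iff: "zero_module (page C (Suc t) x) \<longleftrightarrow> cycles C t x = boundaries C t x"
  unfolding page_Suc
  by (rule zero_module_subquot_iff[OF module_E submodule_cycles submodule_boundaries boundaries_subset_cycles])

end

context couple_morphism
begin

sublocale f: linear_map R "obD C1 x" "obD C2 x" "f x" for x
  by (intro linear_map.intro linear_map_axioms.intro C1.module_D C2.module_D hom_f)

sublocale g: linear_map R "obE C1 x" "obE C2 x" "g x" for x
  by (intro linear_map.intro linear_map_axioms.intro C1.module_E C2.module_E hom_g)

lemma lift_pos_C2 [simp]: "lift_pos C2 t x = lift_pos C1 t x"
  by (simp add: lift_pos_def same_bidegrees)

lemma diff_deg_C2 [simp]: "diff_deg C2 r = diff_deg C1 r"
  by (simp add: diff_deg_def same_bidegrees)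

lemma f_ipow:
  "d \<in> carrier (obD C1 x) \<Longrightarrow>
    f (x + zscale (int r) (ideg C1)) (ipow C1 r x d) = ipow C2 r x (f x d)"
proof (induction r)
  case (Suc r)
  then show ?case
    using comm_i[OF C1.ip.closed[OF Suc.prems, of r]]
    by (simp add: zscale_Suc add.assoc same_bidegrees)
qed simp

text \<open>Naturality of the differentials; it follows by applying \<open>f\<close> to the element \<open>y\<close> that witnesses the relation.\<close>
lemma d_rel_map:
  assumes "d_rel C1 t x e b"
  shows "d_rel C2 t x (g x e) (g (x + diff_deg C1 (Suc t)) b)"
proof -
  let ?w = "lift_pos C1 t x"
  obtain y where y: "y \<in> carrier (obD C1 ?w)" "ipow C1 t ?w y = kmap C1 x e" "b = jmap C1 ?w y"
    and e: "e \<in> carrier (obE C1 x)"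
    using assms by (auto simp: d_rel_def)
  have "ipow C2 t ?w (f ?w y) = kmap C2 x (g x e)"
    using f_ipow[OF y(1), of t] y(2) comm_k[OF e] by simp
  moreover have "g (x + diff_deg C1 (Suc t)) b = jmap C2 ?w (f ?w y)"
    using comm_j[OF y(1)] y(3) by simp
  ultimately show ?thesis
    unfolding d_rel_def lift_pos_C2 using y(1) e by auto
qed

lemma g_cycles: "g x ` cycles C1 t x \<subseteq> cycles C2 t x"
proof (intro image_subsetI)
  fix e assume "e \<in> cycles C1 t x"
  then show "g x e \<in> cycles C2 t x"
    unfolding C1.mem_cycles_iff_d_rel C2.mem_cycles_iff_d_rel using d_rel_map by blast
qed

lemma g_boundaries: "g x ` boundaries C1 t x \<subseteq> boundaries C2 t x"
proof (intro image_subsetI)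
  fix b assume "b \<in> boundaries C1 t x"
  then obtain y where y: "y \<in> carrier (obD C1 (x - jdeg C1))"
      "ipow C1 t (x - jdeg C1) y = \<zero>\<^bsub>obD C1 (x - jdeg C1 + zscale (int t) (ideg C1))\<^esub>"
      "b = jmap C1 (x - jdeg C1) y"
    unfolding C1.mem_boundaries by blast
  have "ipow C2 t (x - jdeg C1) (f (x - jdeg C1) y) =
      \<zero>\<^bsub>obD C2 (x - jdeg C1 + zscale (int t) (ideg C1))\<^esub>"
    using f_ipow[OF y(1), of t] by (simp add: y(2) f.zero)
  moreover have "g x b = jmap C2 (x - jdeg C1) (f (x - jdeg C1) y)"
    using comm_j[OF y(1)] by (simp add: y(3))
  ultimately show "g x b \<in> boundaries C2 t x"
    unfolding C2.mem_boundaries same_bidegrees[symmetric] using y(1) by auto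
qed

lemma page_map_coset:
  "e \<in> carrier (obE C1 x) \<Longrightarrow> page_map C2 g (Suc t) x (boundaries C1 t x +>\<^bsub>obE C1 x\<^esub> e) =
    boundaries C2 t x +>\<^bsub>obE C2 x\<^esub> g x e"
  unfolding page_map_def diff_Suc_1
  by (rule g.quot_map_coset[OF C1.submodule_boundaries C2.submodule_boundaries g_boundaries])

text \<open>Each of the three requirements is checked on a representative, where the induced maps are
  given by \<open>g\<close>.\<close>
lemma ss_morphism_page_map: "ss_morphism R C1 C2 (page_map C2 g)"
  unfolding ss_morphism_def
proof (intro allI impI)
  fix r :: nat and x assume "2 \<le> r"
  then obtain t where r: "r = Suc t" by (cases r) auto
  let ?x' = "x + diff_deg C1 (Suc t)"
  note E1 = C1.E.submodule_closed(1)[OF C1.submodule_cycles]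
  have "page_map C2 g (Suc t) x \<in> mod_hom R (page C1 (Suc t) x) (page C2 (Suc t) x)"
    unfolding page_map_def page_Suc diff_Suc_1
    by (rule g.quot_map_hom[OF C1.submodule_cycles C1.submodule_boundaries C2.submodule_boundaries
          g_cycles g_boundaries])
  moreover have "page_map C2 g (Suc t) ?x' (diff C1 (Suc t) x X) =
      diff C2 (Suc t) x (page_map C2 g (Suc t) x X)" if X_in: "X \<in> carrier (page C1 (Suc t) x)" for X
  proof -
    obtain e where X: "X = boundaries C1 t x +>\<^bsub>obE C1 x\<^esub> e" and "e \<in> cycles C1 t x"
      using X_in unfolding page_Suc subquot_simps by blast
    then obtain b where d: "d_rel C1 t x e b"
      unfolding C1.mem_cycles_iff_d_rel by blast
    show ?thesis
      using C1.d_rel_closed[OF d] C2.diff_coset[OF d_rel_map[OF d]]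
      by (simp add: X C1.diff_coset[OF d] page_map_coset)
  qed
  moreover have "page_to_homology C2 (Suc t) x (page_map C2 g (Suc (Suc t)) x X) =
      quot_map (page C2 (Suc t) x) (diff_image C2 (Suc t) x) (page_map C2 g (Suc t) x)
        (page_to_homology C1 (Suc t) x X)" if X_in: "X \<in> carrier (page C1 (Suc (Suc t)) x)" for X
  proof -
    obtain e where e: "e \<in> cycles C1 (Suc t) x" and X: "X = boundaries C1 (Suc t) x +>\<^bsub>obE C1 x\<^esub> e"
      using X_in unfolding page_Suc subquot_simps by blast
    let ?B = "\<lambda>v. boundaries C2 t x +>\<^bsub>obE C2 x\<^esub> v"
    let ?H = "\<lambda>u. ?B ` (boundaries C2 (Suc t) x +>\<^bsub>obE C2 x\<^esub> g x u)"
    have u: "u \<in> carrier (obE C1 x)" if "u \<in> boundaries C1 (Suc t) x +>\<^bsub>obE C1 x\<^esub> e" for u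
      using that E1[OF e] by (simp add: C1.E.mem_coset_iff[OF C1.submodule_boundaries])
    have H: "?H u = ?H e" if "u \<in> carrier (obE C1 x)" "u \<ominus>\<^bsub>obE C1 x\<^esub> e \<in> boundaries C1 (Suc t) x" for u
    proof -
      have "g x (u \<ominus>\<^bsub>obE C1 x\<^esub> e) \<in> boundaries C2 (Suc t) x"
        using that(2) g_boundaries by blast
      then show ?thesis
        using that(1) E1[OF e] C2.E.coset_eq_iff[OF C2.submodule_boundaries, of "g x e" x "g x u" "Suc t"]
        by (simp add: g.minus)
    qed
    have "quot_map (page C2 (Suc t) x) (diff_image C2 (Suc t) x) (page_map C2 g (Suc t) x)
        (page_to_homology C1 (Suc t) x X) =
      (\<Union>u\<in>boundaries C1 (Suc t) x +>\<^bsub>obE C1 x\<^esub> e.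
         diff_image C2 (Suc t) x +>\<^bsub>page C2 (Suc t) x\<^esub> (?B (g x u)))"
      using u by (simp add: quot_map_def X C1.page_to_homology_coset[OF e] page_map_coset cong: SUP_cong_simp)
    also have "\<dots> = (\<Union>u\<in>boundaries C1 (Suc t) x +>\<^bsub>obE C1 x\<^esub> e. ?H u)"
      using u by (intro SUP_cong refl C2.homology_coset g.closed) auto
    also have "\<dots> = ?H e"
      using E1[OF e] H by (intro C1.E.UN_coset_const[OF C1.submodule_boundaries]) auto
    also have "\<dots> = page_to_homology C2 (Suc t) x (page_map C2 g (Suc (Suc t)) x X)"
    proof -
      have "g x e \<in> cycles C2 (Suc t) x" using e g_cycles by blast
      from C2.page_to_homology_coset[OF this] show ?thesis
        using E1[OF e] by (simp add: X page_map_coset)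
    qed
    finally show ?thesis ..
  qed
  ultimately show "page_map C2 g r x \<in> mod_hom R (page C1 r x) (page C2 r x) \<and>
     (\<forall>X\<in>carrier (page C1 r x).
        page_map C2 g r (x + diff_deg C1 r) (diff C1 r x X) = diff C2 r x (page_map C2 g r x X)) \<and>
     (\<forall>X\<in>carrier (page C1 (Suc r) x).
        page_to_homology C2 r x (page_map C2 g (Suc r) x X)
          = quot_map (page C2 r x) (diff_image C2 r x) (page_map C2 g r x) (page_to_homology C1 r x X))"
    unfolding r by blast
qed

section \<open>Passing from one page to the next and back\<close>

text \<open>The two halves of bijectivity of the map on \<open>E\<^sup>t\<^sup>+\<^sup>1\<close> are kept apart because they hold in different
  ranges of columns.\<close>
definition page_onto :: "nat \<Rightarrow> bideg \<Rightarrow> bool" where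
  "page_onto t x \<longleftrightarrow>
    (\<forall>e'\<in>cycles C2 t x. \<exists>e\<in>cycles C1 t x. e' \<ominus>\<^bsub>obE C2 x\<^esub> g x e \<in> boundaries C2 t x)"

definition page_inj :: "nat \<Rightarrow> bideg \<Rightarrow> bool" where
  "page_inj t x \<longleftrightarrow> (\<forall>e\<in>cycles C1 t x. g x e \<in> boundaries C2 t x \<longrightarrow> e \<in> boundaries C1 t x)"

lemma page_map_iso_iff:
  "page_map C2 g (Suc t) x \<in> mod_iso R (page C1 (Suc t) x) (page C2 (Suc t) x) \<longleftrightarrow>
    page_onto t x \<and> page_inj t x"
  unfolding page_map_def page_Suc diff_Suc_1 page_onto_def page_inj_def
  by (rule g.quot_map_iso_iff[OF C1.submodule_cycles C1.submodule_boundaries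
        C2.submodule_cycles C2.submodule_boundaries g_cycles g_boundaries])

text \<open>Let \<open>e\<close> be a preimage of the class of \<open>e'\<close> on the page \<open>E\<^sup>t\<^sup>+\<^sup>1\<close>. The differential of \<open>e\<close> is mapped to that
  of \<open>e'\<close>, which is \<open>0\<close>, and injectivity at its target shows that it is \<open>0\<close> itself. The conclusion is
  modulo \<open>B\<^sup>t\<close>, which is stronger than surjectivity on the next page.\<close>
lemma cycles_Suc_lift:
  assumes "page_onto t x" and inj: "page_inj t (x + diff_deg C1 (Suc t))"
    and e': "e' \<in> cycles C2 (Suc t) x"
  shows "\<exists>e\<in>cycles C1 (Suc t) x. e' \<ominus>\<^bsub>obE C2 x\<^esub> g x e \<in> boundaries C2 t x"
proof -
  let ?x' = "x + diff_deg C1 (Suc t)"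
  have "e' \<in> cycles C2 t x"
    using e' C2.cycles_Suc_subset by blast
  then obtain e where e: "e \<in> cycles C1 t x" "e' \<ominus>\<^bsub>obE C2 x\<^esub> g x e \<in> boundaries C2 t x"
    using assms(1) unfolding page_onto_def by blast
  obtain b where b: "d_rel C1 t x e b"
    using e(1) unfolding C1.mem_cycles_iff_d_rel by blast
  have carr: "e' \<in> carrier (obE C2 x)" "g x e \<in> carrier (obE C2 x)"
    using C2.E.submodule_closed(1)[OF C2.submodule_cycles e'] C1.d_rel_closed(1)[OF b] by auto
  have "e' \<ominus>\<^bsub>obE C2 x\<^esub> (e' \<ominus>\<^bsub>obE C2 x\<^esub> g x e) \<in> cycles C2 (Suc t) x"
    using e' e(2) C2.boundaries_subset_cycles
    by (blast intro: C2.E.submodule_closed(4)[OF C2.submodule_cycles])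
  then have "g x e \<in> cycles C2 (Suc t) x"
    using carr by (simp add: C2.E.minus_minus_cancel)
  then have "g ?x' b \<in> boundaries C2 t ?x'"
    using C2.d_rel_boundary_iff[OF d_rel_map[OF b]] by simp
  moreover have "b \<in> cycles C1 t ?x'"
    using C1.boundaries_Suc_iff_d_rel C1.boundaries_subset_cycles b by blast
  ultimately have "b \<in> boundaries C1 t ?x'"
    using inj unfolding page_inj_def by blast
  then have "e \<in> cycles C1 (Suc t) x"
    using C1.d_rel_boundary_iff[OF b] by simp
  with e(2) show ?thesis by blast
qed

lemma page_onto_Suc:
  assumes "page_onto t x" "page_inj t (x + diff_deg C1 (Suc t))"
  shows "page_onto (Suc t) x"
  unfolding page_onto_def
  using cycles_Suc_lift[OF assms] C2.boundaries_subset_Suc[of t x] by blast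

text \<open>If \<open>g e\<close> is hit by a differential in the second spectral sequence, then surjectivity at the source
  provides a differential in the first one that hits an element \<open>b\<close> with \<open>g b\<close> equal to \<open>g e\<close> modulo
  \<open>B\<^sup>t\<close>. Injectivity then applies to \<open>e - b\<close>.\<close>
lemma page_inj_Suc:
  assumes inj: "page_inj t x" and onto: "page_onto t (x - diff_deg C1 (Suc t))"
  shows "page_inj (Suc t) x"
  unfolding page_inj_def
proof (intro ballI impI)
  let ?w = "x - diff_deg C1 (Suc t)"
  fix e assume e: "e \<in> cycles C1 (Suc t) x" and ge: "g x e \<in> boundaries C2 (Suc t) x"
  obtain u' where u': "d_rel C2 t ?w u' (g x e)"
    using ge C2.boundaries_Suc_iff_d_rel[of "g x e" t ?w] by auto
  then obtain u where u: "u \<in> cycles C1 t ?w" "u' \<ominus>\<^bsub>obE C2 ?w\<^esub> g ?w u \<in> boundaries C2 t ?w"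
    using onto C2.mem_cycles_iff_d_rel unfolding page_onto_def by blast
  obtain b where b: "d_rel C1 t ?w u b"
    using u(1) unfolding C1.mem_cycles_iff_d_rel by blast
  have carr: "e \<in> carrier (obE C1 x)" "b \<in> carrier (obE C1 x)"
    using C1.E.submodule_closed(1)[OF C1.submodule_cycles e] C1.d_rel_closed(2)[OF b] by auto
  have b': "b \<in> boundaries C1 (Suc t) x"
    using C1.boundaries_Suc_iff_d_rel[of b t ?w] b by auto
  have "u' \<ominus>\<^bsub>obE C2 ?w\<^esub> g ?w u \<in> cycles C2 (Suc t) ?w"
    using u(2) C2.boundaries_subset_cycles by blast
  then have "g x e \<ominus>\<^bsub>obE C2 x\<^esub> g x b \<in> boundaries C2 t x"
    using C2.d_rel_boundary_iff[OF C2.d_rel_minus[OF u' d_rel_map[OF b, simplified]]] by simp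
  then have "g x (e \<ominus>\<^bsub>obE C1 x\<^esub> b) \<in> boundaries C2 t x"
    using carr by (simp add: g.minus)
  moreover have "e \<ominus>\<^bsub>obE C1 x\<^esub> b \<in> cycles C1 t x"
    using e b' C1.cycles_Suc_subset C1.boundaries_subset_cycles
    by (blast intro: C1.E.submodule_closed(4)[OF C1.submodule_cycles])
  ultimately have "e \<ominus>\<^bsub>obE C1 x\<^esub> b \<in> boundaries C1 (Suc t) x"
    using inj C1.boundaries_subset_Suc unfolding page_inj_def by blast
  then have "(e \<ominus>\<^bsub>obE C1 x\<^esub> b) \<oplus>\<^bsub>obE C1 x\<^esub> b \<in> boundaries C1 (Suc t) x"
    using b' by (rule C1.E.submodule_closed(3)[OF C1.submodule_boundaries])
  then show "e \<in> boundaries C1 (Suc t) x"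
    using carr by (simp add: C1.E.minus_add_cancel)
qed

text \<open>When no differential of the page \<open>E\<^sup>t\<^sup>+\<^sup>1\<close> arrives at \<open>x\<close>, the next page is the kernel of the one
  that departs from \<open>x\<close>. A class in the kernel of the map has differential \<open>0\<close>, by
  injectivity at the target, so it lives on the next page.\<close>
lemma page_inj_descend:
  assumes inj: "page_inj (Suc t) x" and target: "page_inj t (x + diff_deg C1 (Suc t))"
    and no_incoming: "boundaries C1 (Suc t) x = boundaries C1 t x"
  shows "page_inj t x"
  unfolding page_inj_def
proof (intro ballI impI)
  let ?x' = "x + diff_deg C1 (Suc t)"
  fix e assume e: "e \<in> cycles C1 t x" and ge: "g x e \<in> boundaries C2 t x"
  obtain b where b: "d_rel C1 t x e b"
    using e unfolding C1.mem_cycles_iff_d_rel by blast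
  have "g x e \<in> cycles C2 (Suc t) x"
    using ge C2.boundaries_subset_cycles by blast
  then have "g ?x' b \<in> boundaries C2 t ?x'"
    using C2.d_rel_boundary_iff[OF d_rel_map[OF b]] by simp
  moreover have "b \<in> cycles C1 t ?x'"
    using C1.boundaries_Suc_iff_d_rel C1.boundaries_subset_cycles b by blast
  ultimately have "b \<in> boundaries C1 t ?x'"
    using target unfolding page_inj_def by blast
  then have "e \<in> cycles C1 (Suc t) x"
    using C1.d_rel_boundary_iff[OF b] by simp
  moreover have "g x e \<in> boundaries C2 (Suc t) x"
    using ge C2.boundaries_subset_Suc by blast
  ultimately show "e \<in> boundaries C1 t x"
    using inj no_incoming unfolding page_inj_def by blast
qed

text \<open>One half of the five lemma for \<open>0 \<rightarrow> E\<^sup>t\<^sup>+\<^sup>2 \<rightarrow> E\<^sup>t\<^sup>+\<^sup>1 \<rightarrow> im d \<rightarrow> 0\<close> at \<open>x\<close>. The assumptions on the target serve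
  to lift \<open>b' = d e'\<close> not just to some cycle \<open>c\<close>, but to an element of the image of \<open>d\<close>: injectivity on the
  page \<open>E\<^sup>t\<^sup>+\<^sup>2\<close> makes \<open>c\<close> a boundary.\<close>
lemma page_onto_descend:
  assumes onto: "page_onto (Suc t) x"
    and target: "page_inj (Suc t) (x + diff_deg C1 (Suc t))" "page_onto t (x + diff_deg C1 (Suc t))"
      "page_inj t (x + diff_deg C1 (Suc t) + diff_deg C1 (Suc t))"
    and no_incoming: "boundaries C2 (Suc t) x = boundaries C2 t x"
  shows "page_onto t x"
  unfolding page_onto_def
proof
  let ?x' = "x + diff_deg C1 (Suc t)"
  fix e' assume "e' \<in> cycles C2 t x"
  then obtain b' where b': "d_rel C2 t x e' b'"
    unfolding C2.mem_cycles_iff_d_rel by blast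
  have b'_bd: "b' \<in> boundaries C2 (Suc t) ?x'"
    using C2.boundaries_Suc_iff_d_rel[of b' t x] b' by auto
  then have "b' \<in> cycles C2 (Suc t) ?x'"
    using C2.boundaries_subset_cycles by blast
  then obtain c where c: "c \<in> cycles C1 (Suc t) ?x'"
      "b' \<ominus>\<^bsub>obE C2 ?x'\<^esub> g ?x' c \<in> boundaries C2 t ?x'"
    using cycles_Suc_lift[OF target(2,3)] by blast
  have c_carr: "c \<in> carrier (obE C1 ?x')" and b'_carr: "b' \<in> carrier (obE C2 ?x')"
    using C1.E.submodule_closed(1)[OF C1.submodule_cycles c(1)] C2.d_rel_closed(2)[OF b'] by auto
  have "b' \<ominus>\<^bsub>obE C2 ?x'\<^esub> (b' \<ominus>\<^bsub>obE C2 ?x'\<^esub> g ?x' c) \<in> boundaries C2 (Suc t) ?x'"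
    using b'_bd c(2) C2.boundaries_subset_Suc
    by (blast intro: C2.E.submodule_closed(4)[OF C2.submodule_boundaries])
  then have "g ?x' c \<in> boundaries C2 (Suc t) ?x'"
    using c_carr b'_carr by (simp add: C2.E.minus_minus_cancel)
  then have "c \<in> boundaries C1 (Suc t) ?x'"
    using target(1) c(1) unfolding page_inj_def by blast
  then obtain u where u: "d_rel C1 t x u c"
    using C1.boundaries_Suc_iff_d_rel by blast
  \<comment> \<open>Subtracting the image of \<open>u\<close> leaves a class with differential \<open>0\<close>, which lives on the next page.\<close>
  have "e' \<ominus>\<^bsub>obE C2 x\<^esub> g x u \<in> cycles C2 (Suc t) x"
    using C2.d_rel_boundary_iff[OF C2.d_rel_minus[OF b' d_rel_map[OF u]]] c(2) by simp
  then obtain v where v: "v \<in> cycles C1 (Suc t) x"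
      "(e' \<ominus>\<^bsub>obE C2 x\<^esub> g x u) \<ominus>\<^bsub>obE C2 x\<^esub> g x v \<in> boundaries C2 t x"
    using onto no_incoming unfolding page_onto_def by blast
  have carr: "e' \<in> carrier (obE C2 x)" "u \<in> carrier (obE C1 x)" "v \<in> carrier (obE C1 x)"
    using C2.d_rel_closed(1)[OF b'] C1.d_rel_closed(1)[OF u]
      C1.E.submodule_closed(1)[OF C1.submodule_cycles v(1)] by auto
  have "u \<in> cycles C1 t x" "v \<in> cycles C1 t x"
    using u v(1) C1.mem_cycles_iff_d_rel C1.cycles_Suc_subset by blast+
  then have "u \<oplus>\<^bsub>obE C1 x\<^esub> v \<in> cycles C1 t x"
    by (rule C1.E.submodule_closed(3)[OF C1.submodule_cycles])
  moreover have "e' \<ominus>\<^bsub>obE C2 x\<^esub> g x (u \<oplus>\<^bsub>obE C1 x\<^esub> v) \<in> boundaries C2 t x"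
    using v(2) carr by (simp add: g.add C2.E.minus_add_eq)
  ultimately show "\<exists>e\<in>cycles C1 t x. e' \<ominus>\<^bsub>obE C2 x\<^esub> g x e \<in> boundaries C2 t x"
    by blast
qed

end

section \<open>The colimit and its filtration\<close>

context exact_couple
begin

lemma mem_cocone:
  "(y, d') \<in> cocone C x d \<longleftrightarrow> d' \<in> carrier (obD C y) \<and>
     (\<exists>r s. x + zscale (int r) (ideg C) = y + zscale (int s) (ideg C) \<and> ipow C r x d = ipow C s y d')"
  by (simp add: cocone_def)

lemma cocone_self: "d \<in> carrier (obD C x) \<Longrightarrow> (x, d) \<in> cocone C x d"
  unfolding mem_cocone by blast

lemma cocone_trans:
  assumes "(y, u) \<in> cocone C x d" "(z, v) \<in> cocone C y u"
  shows "(z, v) \<in> cocone C x d"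
proof -
  let ?a = "ideg C"
  obtain r s r' s' where
    rs: "x + zscale (int r) ?a = y + zscale (int s) ?a" "ipow C r x d = ipow C s y u" and
    rs': "y + zscale (int r') ?a = z + zscale (int s') ?a" "ipow C r' y u = ipow C s' z v" and
    v: "v \<in> carrier (obD C z)"
    using assms unfolding mem_cocone by blast
  have "ipow C (r + r') x d = ipow C (s + r') y u"
    by (simp only: ipow_add rs)
  also have "\<dots> = ipow C (s' + s) z v"
    by (simp only: add.commute[of s r'] ipow_add rs')
  finally have "ipow C (r + r') x d = ipow C (s' + s) z v" .
  moreover have "x + zscale (int (r + r')) ?a = z + zscale (int (s' + s)) ?a"
  proof -
    have "x + zscale (int (r + r')) ?a = y + zscale (int s) ?a + zscale (int r') ?a"
      by (simp only: of_nat_add zscale_add add.assoc[symmetric] rs(1))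
    also have "\<dots> = z + zscale (int s') ?a + zscale (int s) ?a"
      by (simp only: add.assoc add.commute[of "zscale (int s) ?a"] rs'(1)[symmetric])
    finally show ?thesis
      by (simp only: of_nat_add zscale_add add.assoc)
  qed
  ultimately show ?thesis using v unfolding mem_cocone by blast
qed

text \<open>The relation between pairs \<open>(x, d)\<close> that defines the colimit is an equivalence, so every
  representative of an element generates the same class.\<close>
lemma cocone_eqI:
  assumes "(y, u) \<in> cocone C x d" "d \<in> carrier (obD C x)"
  shows "cocone C y u = cocone C x d"
proof -
  have "(x, d) \<in> cocone C y u"
    using assms unfolding mem_cocone by metis
  show ?thesis
  proof (intro equalityI subrelI)
    show "(z, v) \<in> cocone C x d" if "(z, v) \<in> cocone C y u" for z v
      using assms(1) that by (rule cocone_trans)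
    show "(z, v) \<in> cocone C y u" if "(z, v) \<in> cocone C x d" for z v
      using \<open>(x, d) \<in> cocone C y u\<close> that by (rule cocone_trans)
  qed
qed

text \<open>Two representatives at the same position become equal to \<open>d\<close> and \<open>d'\<close> after some shifts, and
  can be compared after a common one. As \<open>i\<close> has nonzero bidegree, the two
  positions determine by how much the numbers of shifts on both sides differ, so a common shift exists.\<close>
lemma cocone_add:
  assumes "ideg C \<noteq> 0" and d: "d \<in> carrier (obD C x)" "d' \<in> carrier (obD C x)"
  shows "cocone C x d \<oplus>\<^bsub>colim C n\<^esub> cocone C x d' = cocone C x (d \<oplus>\<^bsub>obD C x\<^esub> d')"
proof -
  let ?a = "ideg C"
  have eq: "cocone C y (u \<oplus>\<^bsub>obD C y\<^esub> u') = cocone C x (d \<oplus>\<^bsub>obD C x\<^esub> d')"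
    if yu: "(y, u) \<in> cocone C x d" "(y, u') \<in> cocone C x d'" for y u u'
  proof -
    obtain r s r' s' where
      rs: "x + zscale (int r) ?a = y + zscale (int s) ?a" "ipow C r x d = ipow C s y u" and
      rs': "x + zscale (int r') ?a = y + zscale (int s') ?a" "ipow C r' x d' = ipow C s' y u'" and
      u: "u \<in> carrier (obD C y)" "u' \<in> carrier (obD C y)"
      using yu unfolding mem_cocone by blast
    have "zscale (int s + int r') ?a = zscale (int s' + int r) ?a"
    proof -
      have "y + zscale (int s) ?a + zscale (int r') ?a = x + zscale (int r) ?a + zscale (int r') ?a"
        by (simp only: rs(1))
      also have "\<dots> = x + zscale (int r') ?a + zscale (int r) ?a"
        by (simp only: add.assoc add.commute[of "zscale (int r) ?a"])
      also have "\<dots> = y + zscale (int s') ?a + zscale (int r) ?a"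
        by (simp only: rs'(1))
      finally show ?thesis
        by (simp only: zscale_add add.assoc add_left_cancel)
    qed
    then have "int s + int r' = int s' + int r"
      using \<open>?a \<noteq> 0\<close> by (auto simp: zscale_def prod_eq_iff)
    then have S: "s' + r = s + r'" by linarith
    have d1: "ipow C (r + r') x d = ipow C (s + r') y u"
      by (simp only: ipow_add rs)
    have d2: "ipow C (r + r') x d' = ipow C (s + r') y u'"
      by (simp only: add.commute[of r r'] S[symmetric] ipow_add rs')
    have pos: "x + zscale (int (r + r')) ?a = y + zscale (int (s + r')) ?a"
      by (simp only: of_nat_add zscale_add add.assoc[symmetric] rs(1))
    have "ipow C (r + r') x (d \<oplus>\<^bsub>obD C x\<^esub> d') = ipow C (s + r') y (u \<oplus>\<^bsub>obD C y\<^esub> u')"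
      using ip.add[OF d, of "r + r'"] ip.add[OF u, of "s + r'"] by (simp only: pos d1 d2)
    with pos u have "(y, u \<oplus>\<^bsub>obD C y\<^esub> u') \<in> cocone C x (d \<oplus>\<^bsub>obD C x\<^esub> d')"
      unfolding mem_cocone by (metis D.M.a_closed)
    then show ?thesis using d by (intro cocone_eqI) auto
  qed
  have "cocone C x d \<oplus>\<^bsub>colim C n\<^esub> cocone C x d' =
      \<Union>{cocone C y (u \<oplus>\<^bsub>obD C y\<^esub> u') | y u u'. (y, u) \<in> cocone C x d \<and> (y, u') \<in> cocone C x d'}"
    by (simp add: colim_def)
  also have "{cocone C y (u \<oplus>\<^bsub>obD C y\<^esub> u') | y u u'. (y, u) \<in> cocone C x d \<and> (y, u') \<in> cocone C x d'} =
      {cocone C x (d \<oplus>\<^bsub>obD C x\<^esub> d')}" (is "?S = {?c}")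
  proof
    show "?S \<subseteq> {?c}" using eq by blast
    show "{?c} \<subseteq> ?S" using d cocone_self by blast
  qed
  finally show ?thesis by simp
qed

lemma filt_add_closed:
  assumes "ideg C \<noteq> 0" "X \<in> filt C m x" "Y \<in> filt C m x"
  shows "X \<oplus>\<^bsub>colim C n\<^esub> Y \<in> filt C m x"
  using assms(2,3) unfolding filt_def by (auto simp: cocone_add[OF assms(1)])

text \<open>Closure of the stages under subtraction. All elements of a stage have representatives at one
  position, where the difference can be formed, so inverses in the colimit are avoided.\<close>
lemma filt_complement:
  assumes "ideg C \<noteq> 0" "X \<in> filt C m x" "Y \<in> filt C m x"
  shows "\<exists>Z\<in>filt C m x. Y = X \<oplus>\<^bsub>colim C n\<^esub> Z"
proof -
  let ?w = "x - (m, -m)"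
  obtain d d' where d: "d \<in> carrier (obD C ?w)" "d' \<in> carrier (obD C ?w)"
      "X = cocone C ?w d" "Y = cocone C ?w d'"
    using assms(2,3) unfolding filt_def by blast
  have "d \<oplus>\<^bsub>obD C ?w\<^esub> (d' \<ominus>\<^bsub>obD C ?w\<^esub> d) = d'"
    using d(1,2) by (simp add: D.M.a_comm[of d] D.minus_add_cancel)
  then have "Y = X \<oplus>\<^bsub>colim C n\<^esub> cocone C ?w (d' \<ominus>\<^bsub>obD C ?w\<^esub> d)"
    using d by (simp add: cocone_add[OF assms(1)])
  then show ?thesis
    using d(1,2) unfolding filt_def by blast
qed

lemma filt_subset_colim:
  assumes "ideg C = (1, -1)"
  shows "filt C m (p, q) \<subseteq> carrier (colim C (p + q))"
proof -
  have "(p, q) - (m, -m) \<in> line C (p + q)" by (simp add: line_def assms)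
  then show ?thesis by (auto simp: filt_def colim_def)
qed

text \<open>A differential with target \<open>0\<close> imposes no condition on its source.\<close>
lemma cycles_stable:
  assumes "zero_module (page C (Suc t) (x + diff_deg C (Suc t)))"
  shows "cycles C (Suc t) x = cycles C t x"
proof
  show "cycles C t x \<subseteq> cycles C (Suc t) x"
  proof
    fix e assume "e \<in> cycles C t x"
    then obtain b where b: "d_rel C t x e b" unfolding mem_cycles_iff_d_rel by blast
    then have "b \<in> cycles C t (x + diff_deg C (Suc t))"
      using boundaries_Suc_iff_d_rel boundaries_subset_cycles by blast
    then show "e \<in> cycles C (Suc t) x"
      using assms d_rel_boundary_iff[OF b] unfolding zero_page_iff by simp
  qed
qed (rule cycles_Suc_subset)

text \<open>A differential with source \<open>0\<close> hits nothing new.\<close>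
lemma boundaries_stable:
  assumes "zero_module (page C (Suc t) (x - diff_deg C (Suc t)))"
  shows "boundaries C (Suc t) x = boundaries C t x"
proof
  let ?w = "x - diff_deg C (Suc t)"
  show "boundaries C (Suc t) x \<subseteq> boundaries C t x"
  proof
    fix b assume "b \<in> boundaries C (Suc t) x"
    then obtain e where e: "d_rel C t ?w e b"
      using boundaries_Suc_iff_d_rel[of b t ?w] by auto
    then have "e \<in> boundaries C t ?w"
      using assms mem_cycles_iff_d_rel unfolding zero_page_iff by blast
    then have "e \<in> cycles C (Suc t) ?w" using boundaries_subset_cycles by blast
    then show "b \<in> boundaries C t x" using d_rel_boundary_iff[OF e] by simp
  qed
qed (rule boundaries_subset_Suc)

lemma page_inf_eq_page:
  assumes "\<And>s. t \<le> s \<Longrightarrow> cycles C (Suc s) x = cycles C s x"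
    and "\<And>s. t \<le> s \<Longrightarrow> boundaries C (Suc s) x = boundaries C s x"
  shows "(\<Union>r. boundaries C r x) = boundaries C t x" "page_inf C x = page C (Suc t) x"
proof -
  have "cycles C t x \<subseteq> cycles C s x" for s
  proof (cases "t \<le> s")
    case True
    then show ?thesis by (induction rule: dec_induct) (use assms(1) in auto)
  next
    case False
    then show ?thesis
      using lift_Suc_antimono_le[of "\<lambda>r. cycles C r x" s t] cycles_Suc_subset by simp
  qed
  then have Z: "(\<Inter>r. cycles C r x) = cycles C t x" by blast
  have "boundaries C s x \<subseteq> boundaries C t x" for s
  proof (cases "t \<le> s")
    case True
    then show ?thesis by (induction rule: dec_induct) (use assms(2) in auto)
  next
    case False
    then show ?thesis
      using lift_Suc_mono_le[of "\<lambda>r. boundaries C r x" s t] boundaries_subset_Suc by simp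
  qed
  then show B: "(\<Union>r. boundaries C r x) = boundaries C t x" by blast
  show "page_inf C x = page C (Suc t) x"
    by (simp add: page_inf_def page_Suc Z B)
qed

end

lemma homological_ideg:
  assumes "homological_bidegrees C"
  shows "ideg C = (1, -1)"
proof -
  have "diff_deg C 2 = (-2, 1)" "diff_deg C 3 = (-3, 2)"
    using assms by (auto simp: homological_bidegrees_def)
  then show ?thesis
    by (simp add: diff_deg_def zscale_def prod_eq_iff)
qed

text \<open>The short exact sequence \<open>0 \<rightarrow> F\<^sub>p\<^sub>-\<^sub>1\<^sub>,\<^sub>q\<^sub>+\<^sub>1 \<rightarrow> F\<^sub>p\<^sub>,\<^sub>q \<rightarrow> E\<^sup>\<infinity>\<^sub>p\<^sub>,\<^sub>q \<rightarrow> 0\<close>, element by element.\<close>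
lemma (in exact_couple) colim_quotientD:
  assumes "matches_colim R C m \<pi>" "0 \<le> p" "0 \<le> q"
  shows "filt C m (p - 1, q + 1) \<subseteq> filt C m (p, q)"
    and "X \<in> filt C m (p, q) \<Longrightarrow> \<pi> (p, q) X \<in> carrier (page_inf C (p, q))"
    and "\<epsilon> \<in> carrier (page_inf C (p, q)) \<Longrightarrow> \<exists>X\<in>filt C m (p, q). \<pi> (p, q) X = \<epsilon>"
    and "X \<in> filt C m (p, q) \<Longrightarrow> \<pi> (p, q) X = \<zero>\<^bsub>page_inf C (p, q)\<^esub> \<longleftrightarrow> X \<in> filt C m (p - 1, q + 1)"
    and "\<lbrakk>X \<in> filt C m (p, q); Y \<in> filt C m (p, q)\<rbrakk> \<Longrightarrow>
      \<pi> (p, q) (X \<oplus>\<^bsub>colim C (p + q)\<^esub> Y) = \<pi> (p, q) X \<oplus>\<^bsub>page_inf C (p, q)\<^esub> \<pi> (p, q) Y"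
proof -
  let ?F = "(colim C (p + q))\<lparr>carrier := filt C m (p, q)\<rparr>"
  have *: "filt C m (p - 1, q + 1) \<subseteq> filt C m (p, q)" "\<pi> (p, q) \<in> mod_hom R ?F (page_inf C (p, q))"
    "a_kernel ?F (page_inf C (p, q)) (\<pi> (p, q)) = filt C m (p - 1, q + 1)"
    "\<pi> (p, q) ` carrier ?F = carrier (page_inf C (p, q))"
    using assms unfolding matches_colim_def Let_def by (metis add_nonneg_nonneg)+
  show "filt C m (p - 1, q + 1) \<subseteq> filt C m (p, q)" by fact
  have img: "\<pi> (p, q) ` filt C m (p, q) = carrier (page_inf C (p, q))"
    using *(4) by simp
  show "X \<in> filt C m (p, q) \<Longrightarrow> \<pi> (p, q) X \<in> carrier (page_inf C (p, q))"
    and "\<epsilon> \<in> carrier (page_inf C (p, q)) \<Longrightarrow> \<exists>X\<in>filt C m (p, q). \<pi> (p, q) X = \<epsilon>"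
    unfolding img[symmetric] by blast+
  show "X \<in> filt C m (p, q) \<Longrightarrow> \<pi> (p, q) X = \<zero>\<^bsub>page_inf C (p, q)\<^esub> \<longleftrightarrow> X \<in> filt C m (p - 1, q + 1)"
    unfolding *(3)[symmetric] a_kernel_def' by simp
  show "\<lbrakk>X \<in> filt C m (p, q); Y \<in> filt C m (p, q)\<rbrakk> \<Longrightarrow>
      \<pi> (p, q) (X \<oplus>\<^bsub>colim C (p + q)\<^esub> Y) = \<pi> (p, q) X \<oplus>\<^bsub>page_inf C (p, q)\<^esub> \<pi> (p, q) Y"
    using *(2) unfolding mod_hom_def by simp
qed

section \<open>Comparison of the abutments\<close>

locale abutment_comparison = couple_morphism R C1 C2 f g
  for R :: "('a, 'r) ring_scheme" (structure)
    and C1 :: "('a, 'd1, 'e1) couple" and C2 :: "('a, 'd2, 'e2) couple"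
    and f :: "bideg \<Rightarrow> 'd1 \<Rightarrow> 'd2" and g :: "bideg \<Rightarrow> 'e1 \<Rightarrow> 'e2" +
  fixes m :: int
    and \<pi>1 :: "bideg \<Rightarrow> (bideg \<times> 'd1) set \<Rightarrow> 'e1 set"
    and \<pi>2 :: "bideg \<Rightarrow> (bideg \<times> 'd2) set \<Rightarrow> 'e2 set"
  assumes quadrant: "first_quadrant C1" "first_quadrant C2"
    and bidegrees: "homological_bidegrees C1" "homological_bidegrees C2"
    and abutment: "matches_colim R C1 m \<pi>1" "matches_colim R C2 m \<pi>2"
    and natural: "\<And>p q X. \<lbrakk>0 \<le> p; 0 \<le> q; X \<in> filt C1 m (p, q)\<rbrakk> \<Longrightarrow>
           \<pi>2 (p, q) (colim_map C2 f X) = page_inf_map C2 g (p, q) (\<pi>1 (p, q) X)"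
    and colim_iso: "\<And>n::int. colim_map C2 f \<in> mod_iso R (colim C1 n) (colim C2 n)"
begin

abbreviation "L \<equiv> colim_map C2 f"

lemma ideg_nonzero: "ideg C1 \<noteq> 0" "ideg C2 \<noteq> 0"
  using homological_ideg[OF bidegrees(1)] homological_ideg[OF bidegrees(2)] by (simp_all add: zero_prod_def)

lemma diff_target [simp]: "1 \<le> t \<Longrightarrow> (p, q) + diff_deg C1 (Suc t) = (p - int t - 1, q + int t)"
  and diff_source [simp]: "1 \<le> t \<Longrightarrow> (p, q) - diff_deg C1 (Suc t) = (p + int t + 1, q - int t)"
  using bidegrees(1) by (auto simp: homological_bidegrees_def)

lemma cycles_stable_quadrant:
  assumes "1 \<le> t" "p \<le> int t"
  shows "cycles C1 (Suc t) (p, q) = cycles C1 t (p, q)" "cycles C2 (Suc t) (p, q) = cycles C2 t (p, q)"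
  using assms quadrant by (auto intro!: C1.cycles_stable C2.cycles_stable simp: first_quadrant_def)

lemma boundaries_stable_quadrant:
  assumes "1 \<le> t" "q < int t"
  shows "boundaries C1 (Suc t) (p, q) = boundaries C1 t (p, q)"
    "boundaries C2 (Suc t) (p, q) = boundaries C2 t (p, q)"
  using assms quadrant by (auto intro!: C1.boundaries_stable C2.boundaries_stable simp: first_quadrant_def)

text \<open>Once \<open>t \<ge> p\<close> and \<open>t > q\<close>, the differentials that leave and reach \<open>(p, q)\<close> have their other ends
  outside the quadrant.\<close>
lemma page_inf_stable:
  assumes "1 \<le> t" "p \<le> int t" "q < int t"
  shows "page_inf C1 (p, q) = page C1 (Suc t) (p, q)" "page_inf C2 (p, q) = page C2 (Suc t) (p, q)"
    "page_inf_map C2 g (p, q) = page_map C2 g (Suc t) (p, q)"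
proof -
  have "1 \<le> s" "p \<le> int s" "q < int s" if "t \<le> s" for s
    using assms that by auto
  note stable = cycles_stable_quadrant[OF this(1,2)] boundaries_stable_quadrant[OF this(1,3)]
  show "page_inf C1 (p, q) = page C1 (Suc t) (p, q)"
    by (rule C1.page_inf_eq_page(2)[OF stable(1,3)])
  show "page_inf C2 (p, q) = page C2 (Suc t) (p, q)"
    by (rule C2.page_inf_eq_page(2)[OF stable(2,4)])
  have "(\<Union>r. boundaries C2 r (p, q)) = boundaries C2 t (p, q)"
    by (rule C2.page_inf_eq_page(1)[OF stable(2,4)])
  then show "page_inf_map C2 g (p, q) = page_map C2 g (Suc t) (p, q)"
    by (simp add: page_inf_map_def page_map_def)
qed

lemma colim_map_cocone:
  assumes d: "d \<in> carrier (obD C1 x)"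
  shows "L (cocone C1 x d) = cocone C2 x (f x d)"
proof -
  have "cocone C2 y (f y u) = cocone C2 x (f x d)" if yu: "(y, u) \<in> cocone C1 x d" for y u
  proof -
    obtain r s where rs: "x + zscale (int r) (ideg C1) = y + zscale (int s) (ideg C1)"
        "ipow C1 r x d = ipow C1 s y u" and u: "u \<in> carrier (obD C1 y)"
      using yu unfolding C1.mem_cocone by blast
    have "ipow C2 r x (f x d) = ipow C2 s y (f y u)"
      using f_ipow[OF d, of r] f_ipow[OF u, of s] by (simp only: rs)
    then have "(y, f y u) \<in> cocone C2 x (f x d)"
      using rs(1) u unfolding C2.mem_cocone same_bidegrees by auto
    then show ?thesis using d by (intro C2.cocone_eqI) auto
  qed
  then show ?thesis
    unfolding colim_map_def using C1.cocone_self[OF d] by blast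
qed

lemma colim_map_filt: "X \<in> filt C1 m x \<Longrightarrow> L X \<in> filt C2 m x"
  unfolding filt_def by (auto simp: colim_map_cocone)

definition filt_onto :: "bideg \<Rightarrow> bool" where
  "filt_onto x \<longleftrightarrow> (\<forall>Y\<in>filt C2 m x. \<exists>X\<in>filt C1 m x. L X = Y)"

text \<open>One half of the five lemma for \<open>0 \<rightarrow> F\<^sub>p\<^sub>-\<^sub>1\<^sub>,\<^sub>q\<^sub>+\<^sub>1 \<rightarrow> F\<^sub>p\<^sub>,\<^sub>q \<rightarrow> E\<^sup>\<infinity>\<^sub>p\<^sub>,\<^sub>q \<rightarrow> 0\<close>: surjectivity on both ends gives
  surjectivity in the middle.\<close>
lemma filt_onto_step:
  assumes pq: "0 \<le> p" "0 \<le> q" and t: "1 \<le> t" "p \<le> int t" "q < int t"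
    and onto: "page_onto t (p, q)" and prev: "filt_onto (p - 1, q + 1)"
  shows "filt_onto (p, q)"
  unfolding filt_onto_def
proof
  note inf = page_inf_stable[OF t]
  note D1 = C1.colim_quotientD[OF abutment(1) pq] and D2 = C2.colim_quotientD[OF abutment(2) pq]
  let ?E = "obE C2 (p, q)" and ?B = "boundaries C2 t (p, q)"
  note Z2 = C2.E.submodule_closed(1)[OF C2.submodule_cycles]
  note Z1 = C1.E.submodule_closed(1)[OF C1.submodule_cycles]
  fix Y assume Y: "Y \<in> filt C2 m (p, q)"
  obtain e' where e': "e' \<in> cycles C2 t (p, q)" "\<pi>2 (p, q) Y = ?B +>\<^bsub>?E\<^esub> e'"
    using D2(2)[OF Y] by (auto simp: inf page_Suc)
  obtain e where e: "e \<in> cycles C1 t (p, q)" "e' \<ominus>\<^bsub>?E\<^esub> g (p, q) e \<in> ?B"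
    using onto e'(1) unfolding page_onto_def by blast
  obtain X where X: "X \<in> filt C1 m (p, q)"
      "\<pi>1 (p, q) X = boundaries C1 t (p, q) +>\<^bsub>obE C1 (p, q)\<^esub> e"
    using D1(3)[of "boundaries C1 t (p, q) +>\<^bsub>obE C1 (p, q)\<^esub> e"] e(1) by (auto simp: inf page_Suc)
  have LX: "L X \<in> filt C2 m (p, q)" by (rule colim_map_filt[OF X(1)])
  have same: "\<pi>2 (p, q) (L X) = \<pi>2 (p, q) Y"
    using e(2) natural[OF pq X(1)] Z1[OF e(1)] Z2[OF e'(1)]
      C2.E.coset_eq_iff[OF C2.submodule_boundaries, of "g (p, q) e" "(p, q)" e' t]
    by (simp add: X(2) e'(2) inf page_map_coset)
  \<comment> \<open>The difference \<open>W\<close> of \<open>Y\<close> and \<open>L X\<close> vanishes in \<open>E\<^sup>\<infinity>\<close>, so it comes from the previous stage.\<close>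
  obtain W where W: "W \<in> filt C2 m (p, q)" "Y = L X \<oplus>\<^bsub>colim C2 (p + q)\<^esub> W"
    using C2.filt_complement[OF ideg_nonzero(2) LX Y] by blast
  obtain w where w: "w \<in> cycles C2 t (p, q)" "\<pi>2 (p, q) W = ?B +>\<^bsub>?E\<^esub> w"
    using D2(2)[OF W(1)] by (auto simp: inf page_Suc)
  have "?B +>\<^bsub>?E\<^esub> e' = ?B +>\<^bsub>?E\<^esub> (e' \<oplus>\<^bsub>?E\<^esub> w)"
    using D2(5)[OF LX W(1)] Z2[OF e'(1)] Z2[OF w(1)]
    by (simp add: same e'(2) w(2) inf page_Suc C2.E.coset_add[OF C2.submodule_boundaries] flip: W(2))
  then have "(e' \<oplus>\<^bsub>?E\<^esub> w) \<ominus>\<^bsub>?E\<^esub> e' \<in> ?B"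
    using C2.E.coset_eq_iff[OF C2.submodule_boundaries, of e' "(p, q)" "e' \<oplus>\<^bsub>?E\<^esub> w" t]
      Z2[OF e'(1)] Z2[OF w(1)] by simp
  then have "w \<in> ?B"
    using Z2[OF e'(1)] Z2[OF w(1)] by (simp add: C2.E.add_minus_cancel)
  then have "W \<in> filt C2 m (p - 1, q + 1)"
    using D2(4)[OF W(1)] C2.E.coset_eq_self_iff[OF C2.submodule_boundaries Z2[OF w(1)], of t]
    by (simp add: w(2) inf page_Suc)
  then obtain X' where X': "X' \<in> filt C1 m (p - 1, q + 1)" "L X' = W"
    using prev unfolding filt_onto_def by blast
  have X'_in: "X' \<in> filt C1 m (p, q)" using X'(1) D1(1) by blast
  have "L (X \<oplus>\<^bsub>colim C1 (p + q)\<^esub> X') = L X \<oplus>\<^bsub>colim C2 (p + q)\<^esub> L X'"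
    using colim_iso[of "p + q"] X(1) X'_in C1.filt_subset_colim[OF homological_ideg[OF bidegrees(1)]]
    unfolding mod_iso_def mod_hom_def by blast
  then have "L (X \<oplus>\<^bsub>colim C1 (p + q)\<^esub> X') = Y" by (simp add: X'(2) W(2))
  then show "\<exists>X\<in>filt C1 m (p, q). L X = Y"
    using C1.filt_add_closed[OF ideg_nonzero(1) X(1) X'_in] by blast
qed

text \<open>If the class of \<open>X\<close> is killed in \<open>E\<^sup>\<infinity>\<close>, then \<open>L X\<close> lies in the previous stage and is the image of some
  \<open>X'\<close> in the previous stage; injectivity on the whole colimit gives \<open>X' = X\<close>.\<close>
lemma page_inj_if_filt_onto:
  assumes pq: "0 \<le> p" "0 \<le> q" and t: "1 \<le> t" "p \<le> int t" "q < int t"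
    and prev: "filt_onto (p - 1, q + 1)"
  shows "page_inj t (p, q)"
  unfolding page_inj_def
proof (intro ballI impI)
  note inf = page_inf_stable[OF t]
  note D1 = C1.colim_quotientD[OF abutment(1) pq] and D2 = C2.colim_quotientD[OF abutment(2) pq]
  note Z1 = C1.E.submodule_closed(1)[OF C1.submodule_cycles]
  note F = subsetD[OF C1.filt_subset_colim[OF homological_ideg[OF bidegrees(1)]]]
  fix e assume e: "e \<in> cycles C1 t (p, q)" and ge: "g (p, q) e \<in> boundaries C2 t (p, q)"
  obtain X where X: "X \<in> filt C1 m (p, q)"
      "\<pi>1 (p, q) X = boundaries C1 t (p, q) +>\<^bsub>obE C1 (p, q)\<^esub> e"
    using D1(3)[of "boundaries C1 t (p, q) +>\<^bsub>obE C1 (p, q)\<^esub> e"] e(1) by (auto simp: inf page_Suc)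
  have "\<pi>2 (p, q) (L X) = boundaries C2 t (p, q)"
    using natural[OF pq X(1)] Z1[OF e] ge
      C2.E.coset_eq_self_iff[OF C2.submodule_boundaries, of "g (p, q) e" "(p, q)" t]
    by (simp add: X(2) inf page_map_coset)
  then have "L X \<in> filt C2 m (p - 1, q + 1)"
    using D2(4)[OF colim_map_filt[OF X(1)]] by (simp add: inf page_Suc)
  then obtain X' where X': "X' \<in> filt C1 m (p - 1, q + 1)" "L X' = L X"
    using prev unfolding filt_onto_def by blast
  have "X' = X"
    using colim_iso[of "p + q"] X' F[OF X(1)] F[OF subsetD[OF D1(1) X'(1)]]
    unfolding mod_iso_def bij_betw_def by (auto dest: inj_onD)
  then have "\<pi>1 (p, q) X = boundaries C1 t (p, q)"
    using D1(4)[OF X(1)] X'(1) by (simp add: inf page_Suc)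
  then show "e \<in> boundaries C1 t (p, q)"
    using C1.E.coset_eq_self_iff[OF C1.submodule_boundaries Z1[OF e], of t] by (simp add: X(2))
qed

lemma page_onto_if_filt_onto:
  assumes pq: "0 \<le> p" "0 \<le> q" and t: "1 \<le> t" "p \<le> int t" "q < int t"
    and onto: "filt_onto (p, q)"
  shows "page_onto t (p, q)"
  unfolding page_onto_def
proof
  note inf = page_inf_stable[OF t]
  note D1 = C1.colim_quotientD[OF abutment(1) pq] and D2 = C2.colim_quotientD[OF abutment(2) pq]
  note Z2 = C2.E.submodule_closed(1)[OF C2.submodule_cycles]
  note Z1 = C1.E.submodule_closed(1)[OF C1.submodule_cycles]
  let ?E = "obE C2 (p, q)" and ?B = "boundaries C2 t (p, q)"
  fix e' assume e': "e' \<in> cycles C2 t (p, q)"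
  obtain Y where Y: "Y \<in> filt C2 m (p, q)" "\<pi>2 (p, q) Y = ?B +>\<^bsub>?E\<^esub> e'"
    using D2(3)[of "?B +>\<^bsub>?E\<^esub> e'"] e' by (auto simp: inf page_Suc)
  obtain X where X: "X \<in> filt C1 m (p, q)" "L X = Y"
    using onto Y(1) unfolding filt_onto_def by blast
  obtain e where e: "e \<in> cycles C1 t (p, q)" "\<pi>1 (p, q) X = boundaries C1 t (p, q) +>\<^bsub>obE C1 (p, q)\<^esub> e"
    using D1(2)[OF X(1)] by (auto simp: inf page_Suc)
  have "?B +>\<^bsub>?E\<^esub> e' = ?B +>\<^bsub>?E\<^esub> g (p, q) e"
    using natural[OF pq X(1)] Z1[OF e(1)] by (simp add: X(2) Y(2) e(2) inf page_map_coset)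
  then have "e' \<ominus>\<^bsub>?E\<^esub> g (p, q) e \<in> ?B"
    using C2.E.coset_eq_iff[OF C2.submodule_boundaries g.closed[OF Z1[OF e(1)]] Z2[OF e'], of t] by simp
  with e(1) show "\<exists>e\<in>cycles C1 t (p, q). e' \<ominus>\<^bsub>?E\<^esub> g (p, q) e \<in> ?B" by blast
qed

section \<open>The induction over the columns\<close>

text \<open>Surjectivity at \<open>p\<close> on the next page needs injectivity at the target, in column \<open>p - t - 1\<close>, while
  injectivity needs surjectivity at the source, in column \<open>p + t + 1\<close>. The bound \<open>n\<close> for
  surjectivity and the bound \<open>n - t\<close> for injectivity, which drops by one on each page, leave exactly
  the room for both.\<close>
lemma page_iso_propagates:
  assumes "\<And>p q. p \<le> n \<Longrightarrow> page_onto 1 (p, q) \<and> page_inj 1 (p, q)" and "1 \<le> t"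
  shows "(\<forall>p q. p \<le> n \<longrightarrow> page_onto t (p, q)) \<and> (\<forall>p q. p \<le> n - int t \<longrightarrow> page_inj t (p, q))"
  using \<open>1 \<le> t\<close>
proof (induction t rule: nat_induct_at_least)
  case base
  show ?case using assms(1) by simp
next
  case (Suc t)
  have "page_onto (Suc t) (p, q)" if "p \<le> n" for p q
    using Suc that by (intro page_onto_Suc) auto
  moreover have "page_inj (Suc t) (p, q)" if "p \<le> n - int (Suc t)" for p q
    using Suc that by (intro page_inj_Suc) auto
  ultimately show ?case by blast
qed

text \<open>The step from the columns \<open>p \<le> n\<close> to the entry \<open>(n + 1, 0)\<close>: forward to \<open>E\<^sup>\<infinity>\<close>, through the abutment,
  and back.\<close>
lemma page_iso_next_corner:
  assumes n: "0 \<le> n" and iso: "\<And>p q. p \<le> n \<Longrightarrow> page_onto 1 (p, q) \<and> page_inj 1 (p, q)"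
  shows "page_onto 1 (n + 1, 0) \<and> page_inj 1 (n + 1, 0)"
proof -
  have onto: "page_onto t (p, q)" if "1 \<le> t" "p \<le> n" for t p q
    using page_iso_propagates[OF iso] that by blast
  have inj: "page_inj t (p, q)" if "1 \<le> t" "p \<le> n - int t" for t p q
    using page_iso_propagates[OF iso] that by blast
  have filt_onto: "filt_onto (p, N - p)" if "0 \<le> N" "-1 \<le> p" "p \<le> n" "p \<le> N" for p N
    using that(2,3,4)
  proof (induction p rule: int_ge_induct)
    case base
    have "filt C1 m (-1, N + 1) \<noteq> {}" "filt C2 m (-1, N + 1) = {\<zero>\<^bsub>colim C2 N\<^esub>}"
      using abutment \<open>0 \<le> N\<close> unfolding matches_colim_def by auto
    then show ?case
      using colim_map_filt[of _ "(-1, N + 1)"] unfolding filt_onto_def by fastforce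
  next
    case (step p)
    \<comment> \<open>In total degree \<open>N\<close> all entries in the quadrant have become stable at this index.\<close>
    define t where "t = nat (N + 1)"
    show ?case
      by (rule filt_onto_step[of _ _ t]) (use step onto[of t] \<open>0 \<le> N\<close> in \<open>auto simp: t_def algebra_simps\<close>)
  qed
  have inj_inf: "page_inj t (p, q)"
    if "1 \<le> t" "p \<le> n + 1" "0 \<le> p" "0 \<le> q" "p \<le> int t" "q < int t" for t p q
    using that filt_onto[of "p + q" "p - 1"] by (intro page_inj_if_filt_onto) (auto simp: algebra_simps)
  \<comment> \<open>These are the places that \<open>(n + 1, 0)\<close> is connected to by the differential of \<open>E\<^sup>t\<^sup>+\<^sup>1\<close>. Later
    differentials into \<open>(n - t, t)\<close> start below the quadrant, so injectivity descends from \<open>E\<^sup>\<infinity>\<close>.\<close>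
  have inj_target: "page_inj s (n - int t, int t)" if "1 \<le> t" "t < s" for s t
  proof (cases "n - int t < 0")
    case True
    then have "zero_module (page C1 (Suc s) (n - int t, int t))"
      using quadrant(1) that unfolding first_quadrant_def by simp
    then show ?thesis
      unfolding C1.zero_page_iff page_inj_def by blast
  next
    case False
    \<comment> \<open>Large enough for \<open>(n - t, t)\<close> to be stable, and at least \<open>s\<close>.\<close>
    define T where "T = s + nat n"
    have "s \<le> T" by (simp add: T_def)
    then show ?thesis
    proof (induction rule: inc_induct)
      case base
      show ?case using that False by (intro inj_inf) (auto simp: T_def)
    next
      case (step k)
      then have k: "1 \<le> k" "t < k" using that by auto
      show ?case
      proof (rule page_inj_descend)
        show "page_inj (Suc k) (n - int t, int t)" by fact
        show "page_inj k ((n - int t, int t) + diff_deg C1 (Suc k))"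
          unfolding diff_target[OF k(1)] using k by (intro inj) auto
        show "boundaries C1 (Suc k) (n - int t, int t) = boundaries C1 k (n - int t, int t)"
          using k by (intro boundaries_stable_quadrant) auto
      qed
    qed
  qed
  define T where "T = nat (n + 1)"
  \<comment> \<open>The last stage of the filtration is the whole colimit.\<close>
  have "filt_onto (n + 1, 0)"
  proof -
    have "filt C1 m (n + 1, 0) = carrier (colim C1 (n + 1))" "filt C2 m (n + 1, 0) = carrier (colim C2 (n + 1))"
      using abutment n unfolding matches_colim_def by auto
    then have "L ` filt C1 m (n + 1, 0) = filt C2 m (n + 1, 0)"
      using colim_iso[of "n + 1"] by (simp add: mod_iso_def bij_betw_def)
    then show ?thesis
      unfolding filt_onto_def by (metis (no_types, lifting) imageE)
  qed
  then have base: "page_onto T (n + 1, 0) \<and> page_inj T (n + 1, 0)"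
    using n by (auto intro!: page_onto_if_filt_onto inj_inf simp: T_def)
  have "1 \<le> T" using n by (simp add: T_def)
  then show ?thesis
  proof (induction rule: inc_induct)
    case base
    show ?case by fact
  next
    case (step t)
    then have t: "1 \<le> t" by simp
    let ?x' = "(n + 1, 0) + diff_deg C1 (Suc t)"
    have target: "page_inj t ?x'" "page_onto t ?x'" "page_inj (Suc t) ?x'"
        "page_inj t (?x' + diff_deg C1 (Suc t))"
      using t inj[of t "n - int t"] onto[of t "n - int t"] inj_target[of t "Suc t"]
        inj[of t "n - int t - int t - 1"]
      by simp_all
    have no_incoming: "boundaries C1 (Suc t) (n + 1, 0) = boundaries C1 t (n + 1, 0)"
        "boundaries C2 (Suc t) (n + 1, 0) = boundaries C2 t (n + 1, 0)"
      using t boundaries_stable_quadrant[of t 0 "n + 1"] by simp_all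
    have "page_inj t (n + 1, 0)"
      using page_inj_descend[OF _ target(1) no_incoming(1)] step.IH by blast
    moreover have "page_onto t (n + 1, 0)"
      using page_onto_descend[OF _ target(3,2,4) no_incoming(2)] step.IH by blast
    ultimately show ?case by blast
  qed
qed

end

theorem theorem2p6p2:
  fixes R :: "('a, 'r) ring_scheme"
    and C1 :: "('a, 'd1, 'e1) couple" and C2 :: "('a, 'd2, 'e2) couple"
    and f :: "bideg \<Rightarrow> 'd1 \<Rightarrow> 'd2" and g :: "bideg \<Rightarrow> 'e1 \<Rightarrow> 'e2"
    and m :: int
    and \<pi>1 :: "bideg \<Rightarrow> (bideg \<times> 'd1) set \<Rightarrow> 'e1 set"
    and \<pi>2 :: "bideg \<Rightarrow> (bideg \<times> 'd2) set \<Rightarrow> 'e2 set"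
  assumes morphism: "couple_morphism R C1 C2 f g"
    and quadrant: "first_quadrant C1" "first_quadrant C2"
    and bidegrees: "homological_bidegrees C1" "homological_bidegrees C2"
    and abutment: "matches_colim R C1 m \<pi>1" "matches_colim R C2 m \<pi>2"
    and natural: "\<And>p q X. \<lbrakk>0 \<le> p; 0 \<le> q; X \<in> filt C1 m (p, q)\<rbrakk> \<Longrightarrow>
           \<pi>2 (p, q) (colim_map C2 f X) = page_inf_map C2 g (p, q) (\<pi>1 (p, q) X)"
    and colim_iso: "\<And>n::int. colim_map C2 f \<in> mod_iso R (colim C1 n) (colim C2 n)"
    and corner_iso: "page_map C2 g 2 (0, 0) \<in> mod_iso R (page C1 2 (0, 0)) (page C2 2 (0, 0))"
    and propagate: "\<And>n::int. \<lbrakk>0 \<le> n;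
             \<And>p::int. \<lbrakk>0 \<le> p; p \<le> n\<rbrakk> \<Longrightarrow>
               page_map C2 g 2 (p, 0) \<in> mod_iso R (page C1 2 (p, 0)) (page C2 2 (p, 0))\<rbrakk> \<Longrightarrow>
           (\<forall>p q :: int. p \<le> n \<longrightarrow>
               page_map C2 g 2 (p, q) \<in> mod_iso R (page C1 2 (p, q)) (page C2 2 (p, q)))"
  shows "ss_isomorphism R C1 C2 (page_map C2 g)"
proof -
  interpret abutment_comparison R C1 C2 f g m \<pi>1 \<pi>2
    using assms by (intro abutment_comparison.intro abutment_comparison_axioms.intro)
  have iso2: "page_map C2 g 2 x \<in> mod_iso R (page C1 2 x) (page C2 2 x) \<longleftrightarrow> page_onto 1 x \<and> page_inj 1 x" for x
    using page_map_iso_iff[of 1 x] by (simp add: numeral_2_eq_2)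
  have second_page: "page_onto 1 (p, q) \<and> page_inj 1 (p, q)" if "0 \<le> n" "p \<le> n" for n p q
    using that
  proof (induction n arbitrary: p q rule: int_ge_induct)
    case base
    have "page_onto 1 (p', 0) \<and> page_inj 1 (p', 0)" if "0 \<le> p'" "p' \<le> 0" for p'
      using that corner_iso unfolding iso2 by simp
    then show ?case
      using propagate[of 0] base unfolding iso2 by blast
  next
    case (step n)
    have "page_onto 1 (p', 0) \<and> page_inj 1 (p', 0)" if "p' \<le> n + 1" for p'
    proof (cases "p' = n + 1")
      case True
      then show ?thesis using page_iso_next_corner[OF step(1)] step.IH by blast
    next
      case False
      then show ?thesis using step.IH that by simp
    qed
    then show ?case
      using propagate[of "n + 1"] step(1,3) unfolding iso2 by auto
  qed
  have "page_map C2 g r x \<in> mod_iso R (page C1 r x) (page C2 r x)" if r2: "2 \<le> r" for r x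
  proof -
    obtain t where r: "r = Suc t" and t: "1 \<le> t"
      using r2 by (cases r) auto
    obtain p q where x: "x = (p, q)" by force
    have "page_onto 1 (p', q') \<and> page_inj 1 (p', q')" for p' q'
      using second_page[of "max 0 p'" p' q'] by simp
    then have "page_onto t (p, q) \<and> page_inj t (p, q)"
      using page_iso_propagates[of "p + int t" t] t by simp
    then show ?thesis
      unfolding r x page_map_iso_iff .
  qed
  then show ?thesis
    unfolding ss_isomorphism_def using ss_morphism_page_map by blast
qed

end
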